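(* Let $X$ be a finite connected graph whose number of edges is not equal to its number of vertices. Let $G$ be a finite abelian group of order $d$, let $\alpha$ be any voltage assignment of elements of $G$ to the edges of $X$, and suppose that the resulting derived graph $Y$ is connected. Then $$|\mathcal J(Y)|=\frac1d\cdot|\mathcal J(X)|\prod_{\chi\ne\chi_0}\chi(\Theta_{Y/X}),$$ where $\Theta_{Y/X}\in\mathbb Z[G]$ is the reduced Stickelberger element, and the product runs over all non-principal irreducible (complex) characters $\chi$ of $G$, each extended $\mathbb Z$-linearly to a ring homomorphism $\mathbb Z[G]\to\mathbb C$.
   Context: Graphs are simple (no loops or multiple edges). For a finite connected graph $X$ with Laplacian $L=D-A$ (degree matrix minus adjacency matrix), the Jacobian $\mathcal J(X)$ is the cokernel of a reduced Laplacian (the matrix obtained from $L$ by deleting the row and column of one vertex); it is a finite abelian group. Let $X$ have vertices $v_1,\dots,v_n$. A voltage assignment with voltage group $G$ assigns to each directed edge $v_i\to v_j$ (for $v_i,v_j$ adjacent) an element $\alpha_{i,j}\in G$ with $\alpha_{j,i}=\alpha_{i,j}^{-1}$. The derived graph $Y$ has vertex set $\{v_{i,g}:1\le i\le n,\ g\in G\}$, and $v_{i,g}$ is adjacent to $v_{j,h}$ if and only if $v_i$ is adjacent to $v_j$ in $X$ and $h=g\alpha_{i,j}$. The voltage adjacency matrix $A_\alpha$ is the $n\times n$ matrix over $\mathbb Z[G]$ with $(i,j)$ entry $\alpha_{i,j}$ if $v_i,v_j$ are adjacent and $0$ otherwise. Let $D_X$ be the diagonal degree matrix of $X$. For $G$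 abelian, the reduced Stickelberger element is $\Theta_{Y/X}=\det(D_X-A_\alpha)\in\mathbb Z[G]$. The principal character $\chi_0$ is the trivial one. *)

theory Defs
  imports
    "Graph_Theory.Graph_Theory"
    "Jordan_Normal_Form.Determinant"
    "HOL-Algebra.Coset"
    "HOL-Library.Poly_Mapping"
begin

text \<open>
  Finite simple graphs are the structures satisfying \<open>pair_graph\<close>, in which an undirected edge
  is a pair of mutually opposite arcs.  Matrices indexed by vertices are taken with respect to a
  list \<open>vs = [v\<^sub>0, \<dots>, v\<^sub>n\<^sub>-\<^sub>1]\<close> that enumerates the vertices without repetition.
\<close>

definition edges :: "'v pair_pre_digraph \<Rightarrow> 'v set set" where
  "edges X = {{u, v} | u v. (u, v) \<in> parcs X}"

definition vertex_enum :: "'v list \<Rightarrow> 'v pair_pre_digraph \<Rightarrow> bool" where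
  "vertex_enum vs X \<longleftrightarrow> distinct vs \<and> set vs = pverts X"

definition degree_mat :: "'v pair_pre_digraph \<Rightarrow> 'v list \<Rightarrow> 'a::semiring_1 mat" where
  "degree_mat X vs = mat (length vs) (length vs)
     (\<lambda>(i, j). if i = j then of_nat (out_degree (with_proj X) (vs ! i)) else 0)"

definition adjacency_mat :: "'v pair_pre_digraph \<Rightarrow> 'v list \<Rightarrow> int mat" where
  "adjacency_mat X vs = mat (length vs) (length vs)
     (\<lambda>(i, j). if (vs ! i, vs ! j) \<in> parcs X then 1 else 0)"

definition laplacian :: "'v pair_pre_digraph \<Rightarrow> 'v list \<Rightarrow> int mat" where
  "laplacian X vs = degree_mat X vs - adjacency_mat X vs"

definition cokernel :: "int mat \<Rightarrow> int vec set monoid" where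
  "cokernel M = monoid_vec TYPE(int) (dim_row M) Mod
     ((\<lambda>x. M *\<^sub>v x) ` carrier_vec (dim_col M))"

text \<open>The Jacobian, computed by deleting the row and column of the vertex \<open>vs ! k\<close>.\<close>

definition jacobian :: "'v pair_pre_digraph \<Rightarrow> 'v list \<Rightarrow> nat \<Rightarrow> int vec set monoid" where
  "jacobian X vs k = cokernel (mat_delete (laplacian X vs) k k)"

text \<open>
  The voltage group is a type of class \<open>{finite, ab_group_add}\<close>, hence written additively:
  \<open>g + \<alpha> u v\<close> and \<open>- \<alpha> u v\<close> stand for the multiplicative $g\alpha_{u,v}$ and $\alpha_{u,v}^{-1}$.
  Values of \<open>\<alpha>\<close> off the arcs of the graph play no role.
\<close>

definition voltage_assignment ::
    "'v pair_pre_digraph \<Rightarrow> ('v \<Rightarrow> 'v \<Rightarrow> 'g::ab_group_add) \<Rightarrow> bool" where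
  "voltage_assignment X \<alpha> \<longleftrightarrow> (\<forall>(u, v) \<in> parcs X. \<alpha> v u = - \<alpha> u v)"

definition derived_graph ::
    "'v pair_pre_digraph \<Rightarrow> ('v \<Rightarrow> 'v \<Rightarrow> 'g::ab_group_add) \<Rightarrow> ('v \<times> 'g) pair_pre_digraph" where
  "derived_graph X \<alpha> =
     \<lparr> pverts = pverts X \<times> UNIV,
       parcs = {((u, g), (v, h)) | u g v h. (u, v) \<in> parcs X \<and> h = g + \<alpha> u v} \<rparr>"

text \<open>
  The group ring $\mathbb{Z}[G]$ is the type \<open>'g \<Rightarrow>\<^sub>0 int\<close> with its convolution product; the group
  element \<open>g\<close> is \<open>Poly_Mapping.single g 1\<close>.
\<close>

definition voltage_adjacency_mat ::
    "'v pair_pre_digraph \<Rightarrow> ('v \<Rightarrow> 'v \<Rightarrow> 'g::ab_group_add) \<Rightarrow> 'v list \<Rightarrow> ('g \<Rightarrow>\<^sub>0 int) mat" where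
  "voltage_adjacency_mat X \<alpha> vs = mat (length vs) (length vs)
     (\<lambda>(i, j). if (vs ! i, vs ! j) \<in> parcs X
               then Poly_Mapping.single (\<alpha> (vs ! i) (vs ! j)) 1 else 0)"

definition stickelberger ::
    "'v pair_pre_digraph \<Rightarrow> ('v \<Rightarrow> 'v \<Rightarrow> 'g::ab_group_add) \<Rightarrow> 'v list \<Rightarrow> ('g \<Rightarrow>\<^sub>0 int)" where
  "stickelberger X \<alpha> vs = Determinant.det (degree_mat X vs - voltage_adjacency_mat X \<alpha> vs)"

text \<open>The irreducible complex characters of an abelian group are the homomorphisms to $\mathbb{C}^\times$.\<close>

definition characters :: "('g::ab_group_add \<Rightarrow> complex) set" where
  "characters = {\<chi>. (\<forall>g. \<chi> g \<noteq> 0) \<and> (\<forall>g h. \<chi> (g + h) = \<chi> g * \<chi> h)}"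

definition principal_character :: "'g::ab_group_add \<Rightarrow> complex" where
  "principal_character = (\<lambda>_. 1)"

definition char_extend :: "('g::ab_group_add \<Rightarrow> complex) \<Rightarrow> ('g \<Rightarrow>\<^sub>0 int) \<Rightarrow> complex" where
  "char_extend \<chi> x =
     (\<Sum>g \<in> Poly_Mapping.keys x. of_int (Poly_Mapping.lookup x g) * \<chi> g)"

end

theory Submission
  imports Defs "Jordan_Normal_Form.Char_Poly"
begin

text \<open>
  Let \<open>J\<close> be the all-ones matrix.  For a Laplacian \<open>L\<close> of size \<open>n\<close> one has
  \<open>det (L + x J) = x n\<^sup>2 \<kappa>\<close>, where \<open>\<kappa>\<close> is any reduced determinant; \<open>\<kappa>\<close> is nonnegative by diagonal
  dominance, and it is the order of the Jacobian.  The matrix \<open>L\<^sub>Y + J\<close> is invariant under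
  translation by \<open>G\<close>, so the characters of \<open>G\<close> block-diagonalise it: the block of the trivial
  character is \<open>L\<^sub>X + d J\<close>, and the block of any other \<open>\<chi>\<close> is \<open>\<chi>\<close> applied entrywise to
  \<open>D\<^sub>X - A\<^sub>\<alpha>\<close>.  Comparing determinants gives
  \<open>(n d)\<^sup>2 \<kappa>\<^sub>Y = d n\<^sup>2 \<kappa>\<^sub>X \<Prod> \<chi>(\<Theta>)\<close>, the product being over \<open>\<chi> \<noteq> \<chi>\<^sub>0\<close>.
\<close>

section \<open>Characters of finite abelian groups\<close>

text \<open>Comparing the determinants of the Laplacians themselves yields only 0 = 0: constant
  vectors lie in their kernels, on \<open>Y\<close> as well as in the block of the trivial
  character. The matrix \<open>J\<close> is chosen because it repairs exactly this and nothing else.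
  It is invariant under translation, and its contribution to the block of \<chi> is the sum of all
  values of \<chi> in every entry, which is \<open>d\<close> for the trivial character and 0 for the
  others. So the factors \<chi>(\<Theta>) are untouched, and the trivial block acquires
  \<open>d J\<close> instead of \<open>J\<close>. Two points need work of their own. Orthogonality
  makes the characters independent, but a square change of basis needs exactly as many characters as
  group elements, hence the count below. And a cokernel determines a determinant only up to sign,
  whereas the claim is an identity of complex numbers, hence the need for nonnegativity.\<close>

definition add_multiple :: "nat \<Rightarrow> 'g::ab_group_add \<Rightarrow> 'g" where
  "add_multiple k x = (\<Sum>i<k. x)"

lemma add_multiple_0 [simp]: "add_multiple 0 x = 0"
  by (simp add: add_multiple_def)

lemma add_multiple_Suc: "add_multiple (Suc k) x = add_multiple k x + x"
  by (simp add: add_multiple_def)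

lemma add_multiple_add: "add_multiple (j + k) x = add_multiple j x + add_multiple k x"
  by (induction k) (simp_all add: add_multiple_Suc add.assoc)

text \<open>In a finite group these are the subgroups; closure under differences is recovered in
  \<open>add_submonoid_diff\<close>.\<close>

definition add_submonoid :: "'g::ab_group_add set \<Rightarrow> bool" where
  "add_submonoid H \<longleftrightarrow> 0 \<in> H \<and> (\<forall>g\<in>H. \<forall>h\<in>H. g + h \<in> H)"

text \<open>Translation by \<open>a\<close> is an injective self-map of the finite set
  \<open>H\<close>, hence onto; the preimage of \<open>b\<close> is \<open>b - a\<close>.\<close>

lemma add_submonoid_diff:
  fixes H :: "'g::{finite, ab_group_add} set"
  assumes "add_submonoid H" "a \<in> H" "b \<in> H"
  shows "b - a \<in> H"
proof -
  have "(+) a ` H = H"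
    using assms by (intro endo_inj_surj) (auto simp: add_submonoid_def)
  then obtain y where "y \<in> H" "b = a + y"
    using assms(3) by (metis imageE)
  then show ?thesis by simp
qed

text \<open>Fixing the value 0 off \<open>H\<close> makes each character of \<open>H\<close> a
  single function on the whole type, so that \<open>card\<close> counts correctly.\<close>

definition characters_on :: "'g::ab_group_add set \<Rightarrow> ('g \<Rightarrow> complex) set" where
  "characters_on H = {\<chi>. (\<forall>g\<in>H. \<chi> g \<noteq> 0) \<and> (\<forall>g\<in>H. \<forall>h\<in>H. \<chi> (g + h) = \<chi> g * \<chi> h) \<and>
     (\<forall>g. g \<notin> H \<longrightarrow> \<chi> g = 0)}"

lemma characters_on_UNIV: "characters_on UNIV = characters"
  by (simp add: characters_on_def characters_def)

lemma characters_on_zero: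
  assumes "add_submonoid H" "\<chi> \<in> characters_on H"
  shows "\<chi> 0 = 1"
proof -
  have "\<chi> (0 + 0) = \<chi> 0 * \<chi> 0" "\<chi> 0 \<noteq> 0"
    using assms unfolding add_submonoid_def characters_on_def by blast+
  then show ?thesis by simp
qed

text \<open>Pigeonhole: two multiples of \<open>x\<close> coincide, and their difference is a
  vanishing positive multiple.\<close>

lemma ex_add_multiple_zero:
  fixes x :: "'g::{finite, ab_group_add}"
  shows "\<exists>m>0. add_multiple m x = 0"
proof -
  have "\<not> inj (\<lambda>k. add_multiple k x)"
    using finite_imageD[of "\<lambda>k. add_multiple k x" "UNIV :: nat set"] by auto
  then obtain i j where "i < j" "add_multiple i x = add_multiple j x"
    by (metis injI linorder_neqE_nat)
  then show ?thesis
    using add_multiple_add[of i "j - i" x] by (intro exI[of _ "j - i"]) auto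
qed

text \<open>Adjoin \<open>x\<close> to \<open>H\<close>. If \<open>m\<close> is the least positive
  number with \<open>m x\<close> in \<open>H\<close>, each element of the larger group is uniquely
  \<open>h + k x\<close> with \<open>k < m\<close>, and a character \<chi> of \<open>H\<close>
  extends by choosing its value at \<open>x\<close> among the \<open>m\<close> roots of z^m =
  \<chi>(m x). Both cardinalities are multiplied by \<open>m\<close>.\<close>

lemma card_characters_on_extend:
  fixes H :: "'g::{finite, ab_group_add} set"
  assumes H: "add_submonoid H" and x: "x \<notin> H"
    and card: "card (characters_on H) = card H"
  shows "\<exists>H' :: 'g set. add_submonoid H' \<and> card (characters_on H') = card H' \<and> card H < card H'"
proof -
  define m where "m = (LEAST m. 0 < m \<and> add_multiple m x \<in> H)"
  have "\<exists>m. 0 < m \<and> add_multiple m x \<in> H"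
    using ex_add_multiple_zero[of x] H by (metis add_submonoid_def)
  then have m: "0 < m" "add_multiple m x \<in> H"
    unfolding m_def by (metis (mono_tags, lifting) LeastI_ex)+
  have least: "add_multiple k x \<notin> H" if "0 < k" "k < m" for k
    using not_less_Least[of k "\<lambda>m. 0 < m \<and> add_multiple m x \<in> H"] that
    by (auto simp: m_def)
  have m1: "1 < m"
    using m x by (cases "m = 1") (auto simp: add_multiple_Suc)
  have add: "g + h \<in> H" if "g \<in> H" "h \<in> H" for g h
    using H that by (auto simp: add_submonoid_def)
  define f where "f = (\<lambda>(h, k). h + add_multiple k x)"
  define H' where "H' = f ` (H \<times> {..<m})"
  \<comment> \<open>Addition of digits with carry: an overflow \<open>m x\<close> lies in
    \<open>H\<close> and is absorbed by the first coordinate.\<close>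
  have carry: "f (h, i) + f (h', j) = (if i + j < m then f (h + h', i + j)
      else f (h + h' + add_multiple m x, i + j - m))" for h h' i j
  proof -
    have "add_multiple i x + add_multiple j x = add_multiple m x + add_multiple (i + j - m) x"
      if "\<not> i + j < m"
      using that add_multiple_add[of m "i + j - m" x] add_multiple_add[of i j x] by simp
    then show ?thesis
      by (cases "i + j < m") (simp_all add: f_def add_multiple_add add.assoc add.left_commute)
  qed
  \<comment> \<open>Equal values put \<open>(j - i) x\<close> into \<open>H\<close>, against the
    minimality of \<open>m\<close>.\<close>
  have uniq: "i = j" if "h \<in> H" "h' \<in> H" "i \<le> j" "j < m" "f (h, i) = f (h', j)" for h h' i j
  proof (rule ccontr)
    assume "i \<noteq> j"
    have "h = h' + add_multiple (j - i) x"
      using that(3,5) add_multiple_add[of i "j - i" x] by (simp add: f_def add.left_commute[of h'])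
    then have "add_multiple (j - i) x = h - h'" by simp
    then have "add_multiple (j - i) x \<in> H"
      using add_submonoid_diff[OF H that(2,1)] by simp
    then show False
      using least[of "j - i"] that \<open>i \<noteq> j\<close> by auto
  qed
  have inj: "inj_on f (H \<times> {..<m})"
  proof (rule inj_onI; clarsimp)
    fix h i h' j
    assume *: "h \<in> H" "i < m" "h' \<in> H" "j < m" "f (h, i) = f (h', j)"
    have "i = j"
      using uniq[of h h' i j] uniq[of h' h j i] * by (cases "i \<le> j") auto
    moreover have "h = h'"
      using *(5) \<open>i = j\<close> by (simp add: f_def)
    ultimately show "h = h' \<and> i = j" by simp
  qed
  have cardH': "card H' = m * card H"
    unfolding H'_def by (simp add: card_image[OF inj] card_cartesian_product)
  have H': "add_submonoid H'"
    unfolding add_submonoid_def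
  proof (intro conjI ballI)
    have "f (0, 0) \<in> H'"
      using H m by (auto simp: H'_def add_submonoid_def)
    then show "0 \<in> H'" by (simp add: f_def)
    fix a b assume "a \<in> H'" "b \<in> H'"
    then obtain h i h' j where *: "h \<in> H" "h' \<in> H" "i < m" "j < m" "a = f (h, i)" "b = f (h', j)"
      by (auto simp: H'_def)
    then show "a + b \<in> H'"
      unfolding *(5,6) carry H'_def using m by (auto intro!: imageI add)
  qed
  have HH': "H \<subseteq> H'"
  proof
    fix h assume "h \<in> H"
    then have "f (h, 0) \<in> H'"
      unfolding H'_def using m by (intro imageI) simp
    then show "h \<in> H'" by (simp add: f_def)
  qed
  have xH': "x \<in> H'"
  proof -
    have "f (0, 1) \<in> H'"
      unfolding H'_def using m1 H by (intro imageI) (simp add: add_submonoid_def)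
    then show ?thesis by (simp add: f_def add_multiple_Suc)
  qed
  \<comment> \<open>The second component is the prospective value at \<open>x\<close>.\<close>
  define S where "S = (SIGMA \<chi>:characters_on H. {z. z ^ m = \<chi> (add_multiple m x)})"
  define \<Phi> where "\<Phi> = (\<lambda>\<chi>. (\<lambda>g. if g \<in> H then \<chi> g else (0::complex), \<chi> x))"
  have mult': "add_multiple k x \<in> H'" for k
    using H' xH' by (induction k) (auto simp: add_submonoid_def add_multiple_Suc)
  have power: "\<chi> (add_multiple k x) = \<chi> x ^ k" if "\<chi> \<in> characters_on H'" for \<chi> k
  proof (induction k)
    case 0
    then show ?case using characters_on_zero[OF H' that] by simp
  next
    case (Suc k)
    then show ?case
      using that mult'[of k] xH' by (simp add: add_multiple_Suc characters_on_def)
  qed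
  have decomp: "\<chi> (f (h, k)) = \<chi> h * \<chi> x ^ k" if "\<chi> \<in> characters_on H'" "h \<in> H" for \<chi> h k
    using that HH' mult'[of k] power[OF that(1), of k]
    by (auto simp: f_def characters_on_def)
  have "bij_betw \<Phi> (characters_on H') S"
  proof (rule bij_betw_imageI)
    show "inj_on \<Phi> (characters_on H')"
    proof (rule inj_onI, rule ext)
      fix \<chi> \<psi> g
      assume *: "\<chi> \<in> characters_on H'" "\<psi> \<in> characters_on H'" "\<Phi> \<chi> = \<Phi> \<psi>"
      have res: "\<chi> h = \<psi> h" if "h \<in> H" for h
        using fun_cong[OF arg_cong[OF *(3), of fst], of h] that by (simp add: \<Phi>_def)
      show "\<chi> g = \<psi> g"
      proof (cases "g \<in> H'")
        case True
        then obtain h k where "h \<in> H" "g = f (h, k)" by (auto simp: H'_def)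
        then show ?thesis using * res[of h] by (simp add: decomp) (simp add: \<Phi>_def)
      qed (use * in \<open>auto simp: characters_on_def\<close>)
    qed
    show "\<Phi> ` characters_on H' = S"
    proof (intro equalityI subsetI)
      fix p assume "p \<in> \<Phi> ` characters_on H'"
      then obtain \<chi> where \<chi>: "\<chi> \<in> characters_on H'" "p = \<Phi> \<chi>" by auto
      have "g \<in> H'" if "g \<in> H" for g
        using HH' that by auto
      then show "p \<in> S"
        using \<chi> add power[OF \<chi>(1), of m] m by (simp add: \<Phi>_def S_def characters_on_def)
    next
      fix p assume "p \<in> S"
      then obtain \<chi> z where p: "p = (\<chi>, z)" and \<chi>: "\<chi> \<in> characters_on H"
        and z: "z ^ m = \<chi> (add_multiple m x)" by (auto simp: S_def)
      have z0: "z \<noteq> 0"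
        using z \<chi> m by (auto simp: characters_on_def power_0_left)
      have \<chi>mult: "\<chi> (a + b) = \<chi> a * \<chi> b" if "a \<in> H" "b \<in> H" for a b
        using \<chi> that by (auto simp: characters_on_def)
      \<comment> \<open>The extension prescribed by \<chi> and \<open>z\<close>, read off the unique
        coordinates of \<open>g\<close>.\<close>
      define \<psi> where "\<psi> = (\<lambda>g. if g \<in> H' then case inv_into (H \<times> {..<m}) f g of (h, k) \<Rightarrow> \<chi> h * z ^ k
        else 0)"
      have \<psi>f: "\<psi> (f (h, k)) = \<chi> h * z ^ k" if "h \<in> H" "k < m" for h k
        using that by (auto simp: \<psi>_def H'_def inv_into_f_f[OF inj])
      have "\<psi> \<in> characters_on H'"
        unfolding characters_on_def mem_Collect_eq
      proof (intro conjI ballI allI impI)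
        fix g assume "g \<in> H'"
        then show "\<psi> g \<noteq> 0"
          using z0 \<chi> by (auto simp: H'_def \<psi>f characters_on_def)
      next
        fix a b assume "a \<in> H'" "b \<in> H'"
        then obtain h i h' j where *: "h \<in> H" "h' \<in> H" "i < m" "j < m" "a = f (h, i)" "b = f (h', j)"
          by (auto simp: H'_def)
        \<comment> \<open>After a carry, the factor \<open>z ^ m\<close> is supplied by \<chi>(m x)
          from the \<open>H\<close>-coordinate.\<close>
        have "z ^ m * z ^ (i + j - m) = z ^ i * z ^ j" if "\<not> i + j < m"
          using that by (simp flip: power_add)
        then show "\<psi> (a + b) = \<psi> a * \<psi> b"
          unfolding *(5,6) carry using * m add
          by (auto simp: \<psi>f \<chi>mult power_add simp flip: z)
      qed (simp add: \<psi>_def)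
      moreover have "\<Phi> \<psi> = p"
      proof -
        have "\<psi> h = \<chi> h" if "h \<in> H" for h
          using \<psi>f[OF that, of 0] m by (simp add: f_def)
        moreover have "\<psi> x = z"
          using \<psi>f[of 0 1] m1 H characters_on_zero[OF H \<chi>]
          by (simp add: f_def add_multiple_Suc add_submonoid_def)
        ultimately show ?thesis
          using \<chi> by (auto simp: \<Phi>_def p characters_on_def)
      qed
      ultimately show "p \<in> \<Phi> ` characters_on H'" by blast
    qed
  qed
  then have "card (characters_on H') = card S"
    by (rule bij_betw_same_card)
  also have "\<dots> = (\<Sum>\<chi>\<in>characters_on H. card {z. z ^ m = \<chi> (add_multiple m x)})"
    unfolding S_def
  proof (rule card_SigmaI)
    \<comment> \<open>Infinite sets have \<open>card\<close> 0, while here the cardinality equals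
      that of the nonempty set \<open>H\<close>.\<close>
    show "finite (characters_on H)"
      using card H by (intro card_ge_0_finite) (auto simp: card_gt_0_iff add_submonoid_def)
    show "\<forall>\<chi>\<in>characters_on H. finite {z. z ^ m = \<chi> (add_multiple m x)}"
      using m by (auto intro!: finite_nth_roots)
  qed
  also have "\<dots> = (\<Sum>\<chi>\<in>characters_on H. m)"
    using m by (intro sum.cong refl card_nth_roots) (auto simp: characters_on_def)
  also have "\<dots> = card H'"
    by (simp add: card cardH')
  finally have "card (characters_on H') = card H'" .
  moreover have "card H < card H'"
    using HH' xH' x by (intro psubset_card_mono) auto
  ultimately show ?thesis using H' by (intro exI[of _ H'] conjI)
qed

text \<open>A largest \<open>H\<close> for which the count is right must be the whole group, since
  otherwise an outside element could be adjoined. The trivial subgroup shows that such an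
  \<open>H\<close> exists. No decomposition into cyclic factors is involved.\<close>

lemma card_characters:
  "card (characters :: ('g::{finite, ab_group_add} \<Rightarrow> complex) set) = card (UNIV :: 'g set)"
proof -
  define P where "P = (\<lambda>H :: 'g set. add_submonoid H \<and> card (characters_on H) = card H)"
  have "characters_on {0 :: 'g} = {\<lambda>g. if g = 0 then 1 else 0}"
    by (auto simp: characters_on_def fun_eq_iff)
  then have "P {0}"
    by (simp add: P_def add_submonoid_def)
  moreover have "\<forall>H. P H \<longrightarrow> card H < Suc (card (UNIV :: 'g set))"
    by (auto simp: less_Suc_eq_le intro: card_mono)
  ultimately have "\<exists>H. P H \<and> (\<forall>H'. P H' \<longrightarrow> card H' \<le> card H)"
    by (rule ex_has_greatest_nat)
  then obtain H where "P H" and max: "\<And>H'. P H' \<Longrightarrow> card H' \<le> card H"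
    by blast
  have "H = UNIV"
  proof (rule ccontr)
    assume "H \<noteq> UNIV"
    then obtain x where "x \<notin> H" by auto
    then show False
      using card_characters_on_extend[of H x] \<open>P H\<close> max unfolding P_def by (metis leD)
  qed
  then show ?thesis
    using \<open>P H\<close> by (simp add: P_def characters_on_UNIV)
qed

section \<open>Orthogonality of characters\<close>

lemma finite_characters: "finite (characters :: ('g::{finite, ab_group_add} \<Rightarrow> complex) set)"
  by (rule card_ge_0_finite) (simp add: card_characters card_gt_0_iff)

lemma character_zero: "\<chi> \<in> characters \<Longrightarrow> \<chi> 0 = 1"
  using characters_on_zero[of UNIV \<chi>] by (simp add: characters_on_UNIV add_submonoid_def)

lemma character_uminus: "\<chi> \<in> characters \<Longrightarrow> \<chi> (- g) = inverse (\<chi> g)"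
proof -
  assume \<chi>: "\<chi> \<in> characters"
  have "\<chi> (- g + g) = \<chi> (- g) * \<chi> g" "\<chi> g \<noteq> 0"
    using \<chi> unfolding characters_def mem_Collect_eq by blast+
  then show ?thesis
    using character_zero[OF \<chi>] by (simp add: field_simps)
qed

lemma principal_character_in: "principal_character \<in> characters"
  by (simp add: principal_character_def characters_def)

text \<open>Translating the summation variable by some \<open>a\<close> with \<chi>(a) different
  from 1 multiplies the sum by \<chi>(a), so the sum vanishes.\<close>

lemma sum_character:
  fixes \<chi> :: "'g::{finite, ab_group_add} \<Rightarrow> complex"
  assumes "\<chi> \<in> characters"
  shows "(\<Sum>g\<in>UNIV. \<chi> g) = (if \<chi> = principal_character then of_nat (card (UNIV :: 'g set)) else 0)"
proof (cases "\<chi> = principal_character")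
  case False
  then obtain a where a: "\<chi> a \<noteq> 1"
    by (auto simp: principal_character_def)
  have "(\<Sum>g\<in>UNIV. \<chi> g) = (\<Sum>g\<in>UNIV. \<chi> (a + g))"
    by (rule sum.reindex_bij_betw[symmetric]) (simp add: bij_plus_right)
  also have "\<dots> = \<chi> a * (\<Sum>g\<in>UNIV. \<chi> g)"
    using assms by (simp add: characters_def sum_distrib_left)
  finally show ?thesis using a False by simp
qed (simp add: principal_character_def)

text \<open>The summand is itself a character of \<open>g\<close>, and it is principal exactly when
  the two characters agree.\<close>

lemma character_orthogonality:
  fixes \<chi> \<psi> :: "'g::{finite, ab_group_add} \<Rightarrow> complex"
  assumes "\<chi> \<in> characters" "\<psi> \<in> characters"
  shows "(\<Sum>g\<in>UNIV. \<chi> (- g) * \<psi> g) = (if \<chi> = \<psi> then of_nat (card (UNIV :: 'g set)) else 0)"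
proof -
  have "\<chi> (- g - h) = \<chi> (- g) * \<chi> (- h)" for g h
    using assms(1) unfolding characters_def diff_conv_add_uminus[of "- g"] by blast
  then have "(\<lambda>g. \<chi> (- g) * \<psi> g) \<in> characters"
    using assms by (simp add: characters_def)
  moreover have "(\<lambda>g. \<chi> (- g) * \<psi> g) = principal_character \<longleftrightarrow> \<chi> = \<psi>"
    using assms
    by (auto simp: principal_character_def character_uminus fun_eq_iff characters_def field_simps)
  ultimately show ?thesis
    using sum_character[of "\<lambda>g. \<chi> (- g) * \<psi> g"] by simp
qed

section \<open>The order of a cokernel\<close>

definition vec_subgroup :: "nat \<Rightarrow> int vec set \<Rightarrow> bool" where
  "vec_subgroup n H \<longleftrightarrow> H \<subseteq> carrier_vec n \<and> 0\<^sub>v n \<in> H \<and> (\<forall>x\<in>H. \<forall>y\<in>H. x - y \<in> H)"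

text \<open>A transversal, used to count cosets by explicit vectors. It may be infinite; its
  \<open>card\<close> is then 0, in agreement with \<open>order\<close> of an infinite
  group.\<close>

definition coset_reps :: "nat \<Rightarrow> int vec set \<Rightarrow> int vec set \<Rightarrow> bool" where
  "coset_reps n H R \<longleftrightarrow> R \<subseteq> carrier_vec n \<and> (\<forall>x\<in>carrier_vec n. \<exists>!r. r \<in> R \<and> x - r \<in> H)"

lemma vec_subgroup_sym:
  assumes "vec_subgroup n H" "x \<in> carrier_vec n" "y \<in> carrier_vec n" "x - y \<in> H"
  shows "y - x \<in> H"
proof -
  have "0\<^sub>v n - (x - y) \<in> H"
    using assms unfolding vec_subgroup_def by blast
  also have "0\<^sub>v n - (x - y) = y - x"
    using assms by (intro eq_vecI) auto
  finally show ?thesis .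
qed

lemma vec_subgroup_trans:
  assumes "vec_subgroup n H" "x \<in> carrier_vec n" "y \<in> carrier_vec n" "z \<in> carrier_vec n"
    and "x - y \<in> H" "y - z \<in> H"
  shows "x - z \<in> H"
proof -
  have "(x - y) - (z - y) \<in> H"
    using assms vec_subgroup_sym[OF assms(1,3,4,6)] by (auto simp: vec_subgroup_def)
  also have "(x - y) - (z - y) = x - z"
    using assms by (intro eq_vecI) auto
  finally show ?thesis .
qed

lemma r_coset_monoid_vec:
  assumes "vec_subgroup n H" "a \<in> carrier_vec n"
  shows "H #>\<^bsub>monoid_vec TYPE(int) n\<^esub> a = {y \<in> carrier_vec n. y - a \<in> H}"
proof (intro equalityI subsetI)
  fix y assume "y \<in> H #>\<^bsub>monoid_vec TYPE(int) n\<^esub> a"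
  then obtain h where h: "h \<in> H" "y = h + a"
    by (auto simp: r_coset_def monoid_vec_simps)
  moreover have "h \<in> carrier_vec n"
    using h assms by (auto simp: vec_subgroup_def)
  moreover have "h + a - a = h"
    using assms \<open>h \<in> carrier_vec n\<close> by (intro eq_vecI) auto
  ultimately show "y \<in> {y \<in> carrier_vec n. y - a \<in> H}"
    using assms by auto
next
  fix y assume "y \<in> {y \<in> carrier_vec n. y - a \<in> H}"
  moreover from this have "y = (y - a) + a"
    using assms by (intro eq_vecI) auto
  ultimately show "y \<in> H #>\<^bsub>monoid_vec TYPE(int) n\<^esub> a"
    by (auto simp: r_coset_def monoid_vec_simps)
qed

text \<open>Sending a representative to its congruence class is a bijection onto the quotient:
  existence of representatives gives surjectivity, uniqueness gives injectivity.\<close>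

lemma order_Mod_eq_card_reps:
  assumes H: "vec_subgroup n H" and R: "coset_reps n H R"
  shows "Coset.order (monoid_vec TYPE(int) n Mod H) = card R"
proof -
  let ?C = "\<lambda>a. {y \<in> carrier_vec n. y - a \<in> H}"
  have R_carrier: "r \<in> carrier_vec n" if "r \<in> R" for r
    using R that by (auto simp: coset_reps_def)
  have refl: "x - x \<in> H" if "x \<in> carrier_vec n" for x
    using H that by (simp add: vec_subgroup_def minus_cancel_vec)
  have eq: "?C a = ?C r" if "a \<in> carrier_vec n" "r \<in> carrier_vec n" "a - r \<in> H" for a r
  proof -
    have "y - a \<in> H \<longleftrightarrow> y - r \<in> H" if "y \<in> carrier_vec n" for y
      using vec_subgroup_trans[OF H \<open>y \<in> carrier_vec n\<close>, of a r]
        vec_subgroup_trans[OF H \<open>y \<in> carrier_vec n\<close>, of r a]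
        vec_subgroup_sym[OF H, of a r] \<open>a \<in> carrier_vec n\<close> \<open>r \<in> carrier_vec n\<close> \<open>a - r \<in> H\<close>
      by blast
    then show ?thesis by blast
  qed
  have "carrier (monoid_vec TYPE(int) n Mod H) = ?C ` carrier_vec n"
    using r_coset_monoid_vec[OF H] by (auto simp: FactGroup_def RCOSETS_def monoid_vec_simps)
  also have "\<dots> = ?C ` R"
  proof (intro equalityI subsetI)
    fix S assume "S \<in> ?C ` carrier_vec n"
    then obtain a where a: "a \<in> carrier_vec n" "S = ?C a" by auto
    then obtain r where r: "r \<in> R" "a - r \<in> H"
      using R unfolding coset_reps_def by blast
    then show "S \<in> ?C ` R"
      unfolding a(2) eq[OF a(1) R_carrier[OF r(1)] r(2)] by blast
  next
    show "S \<in> ?C ` carrier_vec n" if "S \<in> ?C ` R" for S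
      using that R_carrier by blast
  qed
  finally have "carrier (monoid_vec TYPE(int) n Mod H) = ?C ` R" .
  moreover have "inj_on ?C R"
  proof (rule inj_onI)
    fix r s assume *: "r \<in> R" "s \<in> R" "?C r = ?C s"
    have "r \<in> ?C r"
      using refl R_carrier *(1) by blast
    then have "r - s \<in> H"
      unfolding *(3) by simp
    moreover have "\<exists>!q. q \<in> R \<and> r - q \<in> H"
      using R R_carrier[OF *(1)] by (auto simp: coset_reps_def)
    ultimately show "r = s"
      using * R_carrier[of r] refl[of r] by blast
  qed
  ultimately show ?thesis
    by (simp add: order_def card_image)
qed

text \<open>Congruent vectors satisfy the same defining predicate of \<open>f\<close>, so the choice
  depends only on the class. This serves the case of an infinite quotient, where only some
  transversal is required.\<close>

lemma ex_coset_reps: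
  assumes H: "vec_subgroup n H"
  shows "\<exists>R. coset_reps n H R"
proof -
  define f where "f x = (SOME y. y \<in> carrier_vec n \<and> x - y \<in> H)" for x
  have f: "f x \<in> carrier_vec n" "x - f x \<in> H" if "x \<in> carrier_vec n" for x
  proof -
    have "\<exists>y. y \<in> carrier_vec n \<and> x - y \<in> H"
      using that H by (intro exI[of _ x]) (simp add: vec_subgroup_def minus_cancel_vec)
    then have "f x \<in> carrier_vec n \<and> x - f x \<in> H"
      unfolding f_def by (rule someI_ex)
    then show "f x \<in> carrier_vec n" "x - f x \<in> H" by auto
  qed
  have eq: "f x = f y" if "x \<in> carrier_vec n" "y \<in> carrier_vec n" "x - y \<in> H" for x y
  proof -
    have "z \<in> carrier_vec n \<and> x - z \<in> H \<longleftrightarrow> z \<in> carrier_vec n \<and> y - z \<in> H" for z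
      using vec_subgroup_trans[OF H, of x y z] vec_subgroup_trans[OF H, of y x z]
        vec_subgroup_sym[OF H, of x y] that by blast
    then show ?thesis by (simp add: f_def)
  qed
  have "coset_reps n H (f ` carrier_vec n)"
    unfolding coset_reps_def
  proof (intro conjI ballI)
    fix x :: "int vec" assume x: "x \<in> carrier_vec n"
    show "\<exists>!r. r \<in> f ` carrier_vec n \<and> x - r \<in> H"
    proof (rule ex1I)
    show "f x \<in> f ` carrier_vec n \<and> x - f x \<in> H"
      using f x by auto
    fix r assume "r \<in> f ` carrier_vec n \<and> x - r \<in> H"
    then obtain y where y: "y \<in> carrier_vec n" "r = f y" "x - f y \<in> H" by auto
    then have "x - y \<in> H"
      using f[of y] x vec_subgroup_trans[OF H, of x "f y" y] vec_subgroup_sym[OF H, of y "f y"]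
      by blast
    then show "r = f x"
      using eq[of x y] x y by simp
    qed
  qed (use f in auto)
  then show ?thesis by blast
qed

section \<open>Integer column operations and the image lattice\<close>

abbreviation mat_image :: "int mat \<Rightarrow> int vec set" where
  "mat_image M \<equiv> (\<lambda>x. M *\<^sub>v x) ` carrier_vec (dim_col M)"

lemma vec_subgroup_mat_image:
  assumes "M \<in> carrier_mat n m"
  shows "vec_subgroup n (mat_image M)"
  unfolding vec_subgroup_def
proof (intro conjI ballI)
  have "M *\<^sub>v 0\<^sub>v m = 0\<^sub>v n"
    using assms by (intro eq_vecI) auto
  then show "0\<^sub>v n \<in> mat_image M"
    using assms by (metis carrier_matD(2) image_eqI zero_carrier_vec)
  fix x y assume "x \<in> mat_image M" "y \<in> mat_image M"
  then obtain a b where ab: "a \<in> carrier_vec m" "b \<in> carrier_vec m" "x = M *\<^sub>v a" "y = M *\<^sub>v b"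
    using assms by auto
  then have "x - y = M *\<^sub>v (a - b)"
    using mult_minus_distrib_mat_vec[OF assms] by simp
  then show "x - y \<in> mat_image M"
    using ab assms by auto
qed (use assms in auto)

lemma mat_image_mult_subset:
  assumes "M \<in> carrier_mat n m" "E \<in> carrier_mat m k"
  shows "mat_image (M * E) \<subseteq> mat_image M"
proof
  fix x assume "x \<in> mat_image (M * E)"
  then obtain v where "v \<in> carrier_vec k" "x = M *\<^sub>v (E *\<^sub>v v)"
    using assms by (auto simp: assoc_mult_mat_vec)
  then show "x \<in> mat_image M"
    using assms by auto
qed

text \<open>Column addition is right multiplication by an elementary matrix, which can only shrink
  the image; the opposite addition undoes it and gives the other inclusion.\<close>

lemma mat_image_addcol:
  assumes M: "M \<in> carrier_mat n m" and "k < m" "l < m" "k \<noteq> l"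
  shows "mat_image (addcol a l k M) = mat_image M"
proof -
  have sub: "mat_image (addcol b l k N) \<subseteq> mat_image N" if "N \<in> carrier_mat n m" for b and N :: "int mat"
    unfolding addcol_mat[OF that \<open>k < m\<close>] by (rule mat_image_mult_subset[OF that]) auto
  have carrier: "addcol a l k M \<in> carrier_mat n m"
    using M by (intro carrier_matI) simp_all
  have eq: "addcol (- a) l k (addcol a l k M) = M"
    using assms by (intro eq_matI) auto
  show ?thesis
    using sub[OF M, of a] sub[OF carrier, of "- a"] unfolding eq by (rule subset_antisym)
qed

lemma mat_image_swapcols:
  assumes M: "M \<in> carrier_mat n m" and "k < m" "l < m"
  shows "mat_image (swapcols k l M) = mat_image M"
proof -
  have sub: "mat_image (swapcols k l N) \<subseteq> mat_image N" if "N \<in> carrier_mat n m" for N :: "int mat"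
    unfolding swapcols_mat[OF that \<open>k < m\<close> \<open>l < m\<close>] by (rule mat_image_mult_subset[OF that]) auto
  have "swapcols k l (swapcols k l M) = M"
    using assms by (intro eq_matI) auto
  then show ?thesis
    using sub[OF M] sub[of "swapcols k l M"] M by auto
qed

text \<open>The Euclidean algorithm on the first row, terminating because the sum of its absolute
  values decreases. Absolute values of determinants appear because the final swap changes the
  sign.\<close>

lemma clear_first_row:
  fixes M :: "int mat"
  assumes "M \<in> carrier_mat (Suc n) (Suc n)"
  shows "\<exists>N \<in> carrier_mat (Suc n) (Suc n). mat_image N = mat_image M \<and>
    \<bar>det N\<bar> = \<bar>det M\<bar> \<and> (\<forall>j\<in>{1..n}. N $$ (0, j) = 0)"
  using assms
proof (induction "\<Sum>j<Suc n. nat \<bar>M $$ (0, j)\<bar>" arbitrary: M rule: less_induct)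
  case less
  note M = less.prems
  show ?case
  proof (cases "\<exists>j l. j < Suc n \<and> l < Suc n \<and> j \<noteq> l \<and> M $$ (0, j) \<noteq> 0 \<and> M $$ (0, l) \<noteq> 0")
    case True
    then obtain j l where jl: "j < Suc n" "l < Suc n" "j \<noteq> l" "M $$ (0, j) \<noteq> 0"
        "M $$ (0, l) \<noteq> 0" "\<bar>M $$ (0, j)\<bar> \<le> \<bar>M $$ (0, l)\<bar>"
      by (metis linear)
    \<comment> \<open>With this sign the entry at \<open>l\<close> shrinks in absolute value by
      exactly that of the entry at \<open>j\<close>, which is nonzero and not larger.\<close>
    define a where "a = - sgn (M $$ (0, j)) * sgn (M $$ (0, l))"
    define N where "N = addcol a l j M"
    have N: "N \<in> carrier_mat (Suc n) (Suc n)"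
      using M by (intro carrier_matI) (simp_all add: N_def)
    have "\<bar>N $$ (0, l)\<bar> < \<bar>M $$ (0, l)\<bar>"
      using jl M by (auto simp: N_def a_def sgn_if abs_if split: if_splits)
    moreover have other: "N $$ (0, i) = M $$ (0, i)" if "i < Suc n" "i \<noteq> l" for i
      using that M by (simp add: N_def)
    ultimately have "nat \<bar>N $$ (0, i)\<bar> \<le> nat \<bar>M $$ (0, i)\<bar>" if "i < Suc n" for i
      using that by (cases "i = l") auto
    moreover have "nat \<bar>N $$ (0, l)\<bar> < nat \<bar>M $$ (0, l)\<bar>"
      using \<open>\<bar>N $$ (0, l)\<bar> < \<bar>M $$ (0, l)\<bar>\<close> by simp
    then have "\<exists>i\<in>{..<Suc n}. nat \<bar>N $$ (0, i)\<bar> < nat \<bar>M $$ (0, i)\<bar>"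
      using jl(2) by blast
    ultimately have "(\<Sum>j<Suc n. nat \<bar>N $$ (0, j)\<bar>) < (\<Sum>j<Suc n. nat \<bar>M $$ (0, j)\<bar>)"
      by (intro sum_strict_mono_ex1 ballI) simp_all
    moreover have "mat_image N = mat_image M" "det N = det M"
      unfolding N_def using mat_image_addcol[OF M jl(1,2,3)] det_addcol[OF jl(1) jl(3)[symmetric] M]
      by blast+
    ultimately show ?thesis
      using less.hyps[OF _ N] by simp
  next
    case False
    show ?thesis
    proof (cases "\<exists>j\<in>{1..n}. M $$ (0, j) \<noteq> 0")
      case True
      then obtain j where j: "j \<in> {1..n}" "M $$ (0, j) \<noteq> 0" by auto
      \<comment> \<open>Now \<open>j\<close> is the only column with a nonzero first entry, and the
        swap moves it to the front.\<close>
      have "swapcols 0 j M $$ (0, i) = 0" if "i \<in> {1..n}" for i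
      proof -
        have "j < Suc n" using j by simp
        then have "M $$ (0, i') = 0" if "i' < Suc n" "i' \<noteq> j" for i'
          using False j(2) that by blast
        then show ?thesis
          using j that M by auto
      qed
      then show ?thesis
        using mat_image_swapcols[OF M, of 0 j] det_swapcols[OF _ _ _ M, of 0 j] j M
        by (intro bexI[of _ "swapcols 0 j M"]) auto
    qed (use M in auto)
  qed
qed

section \<open>Splitting off the first coordinate\<close>

lemma carrier_vec_Suc_vCons:
  assumes "x \<in> carrier_vec (Suc n)"
  obtains a v where "x = vCons a v" "v \<in> carrier_vec n"
proof
  show "x = vCons (x $ 0) (vec n (\<lambda>i. x $ Suc i))"
    using assms by (intro eq_vecI) (auto simp: vec_index_vCons)
qed simp

text \<open>With its first row cleared, \<open>N\<close> is block lower triangular; this is its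
  action on head and tail of a vector.\<close>

lemma mult_mat_vec_vCons:
  fixes N :: "int mat"
  assumes N: "N \<in> carrier_mat (Suc n) (Suc n)" and row: "\<forall>j\<in>{1..n}. N $$ (0, j) = 0"
    and v: "v \<in> carrier_vec n"
  shows "N *\<^sub>v vCons a v =
    vCons (N $$ (0, 0) * a) (a \<cdot>\<^sub>v vec n (\<lambda>i. N $$ (Suc i, 0)) + mat_delete N 0 0 *\<^sub>v v)"
    (is "?l = ?r")
proof (rule eq_vecI)
  have r: "row N i = vCons (N $$ (i, 0)) (vec n (\<lambda>j. N $$ (i, Suc j)))" if "i < Suc n" for i
    using N that by (intro eq_vecI) (auto simp: vec_index_vCons)
  fix i assume "i < dim_vec ?r"
  then have i: "i < Suc n" using N by simp
  show "?l $ i = ?r $ i"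
  proof (cases i)
    case 0
    have "vec n (\<lambda>j. N $$ (0, Suc j)) = 0\<^sub>v n"
      using row by (intro eq_vecI) auto
    then show ?thesis
      using N v r[of 0] 0 by simp
  next
    case (Suc i')
    have "row (mat_delete N 0 0) i' = vec n (\<lambda>j. N $$ (Suc i', Suc j))"
      using N i Suc by (intro eq_vecI) (auto simp: mat_delete_def)
    then show ?thesis
      using N v r[of i] Suc i by simp
  qed
qed (use N in simp)

lemma det_first_row:
  fixes N :: "'a::comm_ring_1 mat"
  assumes N: "N \<in> carrier_mat (Suc n) (Suc n)" and row: "\<forall>j\<in>{1..n}. N $$ (0, j) = 0"
  shows "det N = N $$ (0, 0) * det (mat_delete N 0 0)"
proof -
  have "det N = (\<Sum>j<Suc n. N $$ (0, j) * cofactor N 0 j)"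
    by (rule laplace_expansion_row[OF N]) simp
  also have "\<dots> = N $$ (0, 0) * cofactor N 0 0"
    using row by (subst sum.lessThan_Suc_shift) (simp add: sum.neutral)
  finally show ?thesis by (simp add: cofactor_def)
qed

text \<open>Once the first row is (g, 0, ..., 0), a congruence of vectors forces the heads to agree
  modulo \<open>g\<close>, and the quotient then fixes a correction of the tail modulo the smaller
  matrix. For \<open>g\<close> nonzero the residues below |g| combined with a smaller transversal
  therefore form a transversal.\<close>

lemma ex_coset_reps_card_det:
  fixes M :: "int mat"
  assumes "M \<in> carrier_mat n n"
  shows "\<exists>R. coset_reps n (mat_image M) R \<and> card R = nat \<bar>det M\<bar>"
  using assms
proof (induction n arbitrary: M)
  case 0
  have "coset_reps 0 (mat_image M) {0\<^sub>v 0}"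
    unfolding coset_reps_def
  proof (intro conjI ballI)
    fix x :: "int vec" assume "x \<in> carrier_vec 0"
    then have "x = 0\<^sub>v 0" by auto
    moreover have "0\<^sub>v 0 - 0\<^sub>v 0 = (0\<^sub>v 0 :: int vec)" by auto
    ultimately show "\<exists>!r. r \<in> {0\<^sub>v 0} \<and> x - r \<in> mat_image M"
      using vec_subgroup_mat_image[OF 0] by (auto simp: vec_subgroup_def)
  qed simp
  then show ?case
    using 0 by (intro exI[of _ "{0\<^sub>v 0}"]) simp
next
  case (Suc n)
  obtain N where N: "N \<in> carrier_mat (Suc n) (Suc n)" and im: "mat_image N = mat_image M"
    and det: "\<bar>det N\<bar> = \<bar>det M\<bar>" and row: "\<forall>j\<in>{1..n}. N $$ (0, j) = 0"
    using clear_first_row[OF Suc.prems] by auto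
  define g c M' where "g = N $$ (0, 0)" and "c = vec n (\<lambda>i. N $$ (Suc i, 0))"
    and "M' = mat_delete N 0 0"
  have M': "M' \<in> carrier_mat n n"
    using mat_delete_carrier[OF N, of 0 0] by (simp add: M'_def)
  have c: "c \<in> carrier_vec n" by (simp add: c_def)
  have detN: "det N = g * det M'"
    using det_first_row[OF N row] by (simp add: g_def M'_def)
  note mult = mult_mat_vec_vCons[OF N row, folded g_def c_def M'_def]
  \<comment> \<open>The multiplier \<open>a\<close> of column 0 is visible in the head; its effect
    \<open>a c\<close> on the tail is moved to the other side.\<close>
  have mem: "vCons b y - vCons r s \<in> mat_image N \<longleftrightarrow>
      (\<exists>a. b - r = g * a \<and> (y - a \<cdot>\<^sub>v c) - s \<in> mat_image M')"
    if ys: "y \<in> carrier_vec n" "s \<in> carrier_vec n" for b y r s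
  proof -
    have diff: "vCons b y - vCons r s = vCons (b - r) (y - s)"
      using ys by (intro eq_vecI) (auto simp: vec_index_vCons)
    have eq: "y - s = a \<cdot>\<^sub>v c + h \<longleftrightarrow> (y - a \<cdot>\<^sub>v c) - s = h" if "h \<in> carrier_vec n" for a h
      using ys that c by (auto simp: vec_eq_iff)
    have "vCons b y - vCons r s \<in> mat_image N \<longleftrightarrow>
        (\<exists>a. \<exists>v\<in>carrier_vec n. vCons (b - r) (y - s) = N *\<^sub>v vCons a v)"
    proof
      assume "vCons b y - vCons r s \<in> mat_image N"
      then obtain x where "x \<in> carrier_vec (Suc n)" "vCons (b - r) (y - s) = N *\<^sub>v x"
        using N by (auto simp: diff)
      moreover from this(1) obtain a v where "x = vCons a v" "v \<in> carrier_vec n"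
        by (rule carrier_vec_Suc_vCons)
      ultimately show "\<exists>a. \<exists>v\<in>carrier_vec n. vCons (b - r) (y - s) = N *\<^sub>v vCons a v"
        by auto
    next
      assume "\<exists>a. \<exists>v\<in>carrier_vec n. vCons (b - r) (y - s) = N *\<^sub>v vCons a v"
      then show "vCons b y - vCons r s \<in> mat_image N"
        using N by (auto simp: diff)
    qed
    also have "\<dots> \<longleftrightarrow> (\<exists>a. b - r = g * a \<and> (\<exists>v\<in>carrier_vec n. y - s = a \<cdot>\<^sub>v c + M' *\<^sub>v v))"
      by (auto simp: mult)
    also have "\<dots> \<longleftrightarrow> (\<exists>a. b - r = g * a \<and> (\<exists>v\<in>carrier_vec n. (y - a \<cdot>\<^sub>v c) - s = M' *\<^sub>v v))"
      using M' by (simp add: eq)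
    finally show ?thesis
      using M' by (auto simp: image_iff)
  qed
  show ?case
  proof (cases "g = 0")
    case True
    obtain R where R: "coset_reps (Suc n) (mat_image N) R"
      using ex_coset_reps[OF vec_subgroup_mat_image[OF N]] by auto
    \<comment> \<open>Elements of the image now have head 0, so every integer must occur as the head
      of a representative. Hence \<open>R\<close> is infinite and its \<open>card\<close> is 0, like
      the determinant.\<close>
    have "\<exists>r\<in>R. b = r $ 0" for b
    proof -
      have "vCons b (0\<^sub>v n) \<in> carrier_vec (Suc n)" by simp
      then obtain r where r: "r \<in> R" "vCons b (0\<^sub>v n) - r \<in> mat_image N"
        using R unfolding coset_reps_def by meson
      then have "r \<in> carrier_vec (Suc n)"
        using R by (auto simp: coset_reps_def)
      then obtain b' s where "r = vCons b' s" "s \<in> carrier_vec n"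
        by (rule carrier_vec_Suc_vCons)
      then have "b = r $ 0"
        using r mem[of "0\<^sub>v n" s b b'] True by auto
      then show ?thesis using r by auto
    qed
    then have "(\<lambda>r. r $ 0) ` R = UNIV" by auto
    then have "infinite R"
      using finite_imageI[of R "\<lambda>r. r $ 0"] infinite_UNIV_int by metis
    then show ?thesis
      using R True detN det im by (intro exI[of _ R]) simp
  next
    case False
    obtain R' where R': "coset_reps n (mat_image M') R'" and card: "card R' = nat \<bar>det M'\<bar>"
      using Suc.IH[OF M'] by auto
    have R'_carrier: "R' \<subseteq> carrier_vec n"
      using R' by (simp add: coset_reps_def)
    define R where "R = (\<lambda>(r, s). vCons r s) ` ({0..<\<bar>g\<bar>} \<times> R')"
    have "coset_reps (Suc n) (mat_image N) R"
      unfolding coset_reps_def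
    proof (intro conjI ballI)
      show "R \<subseteq> carrier_vec (Suc n)"
        using R'_carrier by (auto simp: R_def)
      fix x :: "int vec" assume "x \<in> carrier_vec (Suc n)"
      then obtain b y where x: "x = vCons b y" and y: "y \<in> carrier_vec n"
        by (rule carrier_vec_Suc_vCons)
      \<comment> \<open>The division is by |g|; the factor \<open>sgn g\<close> turns its quotient
        into a multiplier of \<open>g\<close>.\<close>
      define r a where "r = b mod \<bar>g\<bar>" and "a = (b div \<bar>g\<bar>) * sgn g"
      have "b - r = \<bar>g\<bar> * (b div \<bar>g\<bar>)"
        by (simp only: r_def minus_mod_eq_mult_div)
      also have "\<dots> = g * a"
        by (subst (1) abs_sgn) (simp only: a_def mult.assoc mult.commute mult.left_commute)
      finally have ra: "r \<in> {0..<\<bar>g\<bar>}" "b - r = g * a"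
        using False by (simp_all add: r_def)
      have ra_unique: "r' = r \<and> a' = a" if "r' \<in> {0..<\<bar>g\<bar>}" "b - r' = g * a'" for r' a'
      proof -
        have "g * (a' - a) = r - r'"
          using that ra by (simp add: algebra_simps)
        \<comment> \<open>Two residues in [0, |g|) differ by less than |g|.\<close>
        then have "\<bar>g\<bar> * \<bar>a' - a\<bar> < \<bar>g\<bar> * 1"
          using that ra by (auto simp flip: abs_mult)
        then have "a' = a"
          using False by (simp add: mult_less_cancel_left)
        then show ?thesis using that ra by simp
      qed
      have "y - a \<cdot>\<^sub>v c \<in> carrier_vec n" using y c by simp
      then obtain s where s: "s \<in> R'" "(y - a \<cdot>\<^sub>v c) - s \<in> mat_image M'"
          and s_unique: "\<And>s'. s' \<in> R' \<Longrightarrow> (y - a \<cdot>\<^sub>v c) - s' \<in> mat_image M' \<Longrightarrow> s' = s"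
        using R' unfolding coset_reps_def by metis
      show "\<exists>!r. r \<in> R \<and> x - r \<in> mat_image N"
      proof (rule ex1I)
        have "s \<in> carrier_vec n" using s R'_carrier by auto
        then have "x - vCons r s \<in> mat_image N"
          unfolding x using mem[OF y] ra s by blast
        then show "vCons r s \<in> R \<and> x - vCons r s \<in> mat_image N"
          using ra s by (auto simp: R_def)
        fix q assume q: "q \<in> R \<and> x - q \<in> mat_image N"
        then obtain r' s' where rs': "q = vCons r' s'" "r' \<in> {0..<\<bar>g\<bar>}" "s' \<in> R'"
          by (auto simp: R_def)
        then have "s' \<in> carrier_vec n" using R'_carrier by auto
        then obtain a' where "b - r' = g * a'" "(y - a' \<cdot>\<^sub>v c) - s' \<in> mat_image M'"
          using q mem[OF y] unfolding x rs' by blast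
        then show "q = vCons r s"
          using ra_unique rs' s_unique by blast
      qed
    qed
    moreover have "card R = nat \<bar>det M\<bar>"
    proof -
      have "card R = card ({0..<\<bar>g\<bar>} \<times> R')"
        unfolding R_def by (rule card_image) (auto simp: inj_on_def)
      then show ?thesis
        by (simp add: card_cartesian_product card detN abs_mult nat_mult_distrib flip: det)
    qed
    ultimately show ?thesis
      unfolding im by blast
  qed
qed

text \<open>If \<open>det M = 0\<close>, the cokernel is infinite and both sides are \<open>0\<close>.\<close>

lemma order_cokernel:
  assumes "M \<in> carrier_mat n n"
  shows "Coset.order (cokernel M) = nat \<bar>det M\<bar>"
proof -
  obtain R where "coset_reps n (mat_image M) R" "card R = nat \<bar>det M\<bar>"
    using ex_coset_reps_card_det[OF assms] by blast
  then show ?thesis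
    using order_Mod_eq_card_reps[OF vec_subgroup_mat_image[OF assms]] assms
    unfolding cokernel_def by (metis carrier_matD(1))
qed

section \<open>Determinants\<close>

text \<open>Gershgorin's argument: at a coordinate \<open>i\<close> where the eigenvector is largest
  in absolute value, the eigenvalue equation gives |x + A_ii| \<le> A_ii.\<close>

lemma no_positive_eigenvalue_neg_diag_dominant:
  fixes A :: "real mat"
  assumes A: "A \<in> carrier_mat n n"
    and dom: "\<And>i. i < n \<Longrightarrow> (\<Sum>j\<in>{..<n} - {i}. \<bar>A $$ (i, j)\<bar>) \<le> A $$ (i, i)"
    and "eigenvalue (- A) x"
  shows "x \<le> 0"
proof -
  obtain v where v: "v \<in> carrier_vec n" "v \<noteq> 0\<^sub>v n" "- A *\<^sub>v v = x \<cdot>\<^sub>v v"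
    using assms(3) A by (auto simp: eigenvalue_def eigenvector_def)
  obtain l where l: "l < n" "v $ l \<noteq> 0"
    using v(1,2) by (metis carrier_vecD eq_vecI index_zero_vec(1) zero_carrier_vec)
  let ?S = "(\<lambda>j. \<bar>v $ j\<bar>) ` {..<n}"
  have "Max ?S \<in> ?S"
    using l(1) by (intro Max_in) auto
  then obtain i where i: "i < n" "\<bar>v $ i\<bar> = Max ?S"
    by auto
  have max: "\<bar>v $ j\<bar> \<le> \<bar>v $ i\<bar>" if "j < n" for j
    unfolding i(2) using that by (intro Max_ge) auto
  have pos: "0 < \<bar>v $ i\<bar>"
    using max[OF l(1)] l(2) by linarith
  have "(- A *\<^sub>v v) $ i = - (\<Sum>j<n. A $$ (i, j) * v $ j)"
    using A v(1) i(1) by (simp add: scalar_prod_def atLeast0LessThan sum_negf)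
  then have "x * v $ i = - (\<Sum>j<n. A $$ (i, j) * v $ j)"
    using v(1) i(1) unfolding v(3) by simp
  also have "(\<Sum>j<n. A $$ (i, j) * v $ j) = A $$ (i, i) * v $ i + (\<Sum>j\<in>{..<n} - {i}. A $$ (i, j) * v $ j)"
    using i(1) by (intro sum.remove) auto
  finally have "\<bar>(x + A $$ (i, i)) * v $ i\<bar> = \<bar>\<Sum>j\<in>{..<n} - {i}. A $$ (i, j) * v $ j\<bar>"
    by (simp add: algebra_simps abs_minus_commute)
  also have "\<dots> \<le> (\<Sum>j\<in>{..<n} - {i}. \<bar>A $$ (i, j)\<bar> * \<bar>v $ i\<bar>)"
    using max by (intro order.trans[OF sum_abs] sum_mono) (auto simp: abs_mult intro: mult_left_mono)
  also have "\<dots> \<le> A $$ (i, i) * \<bar>v $ i\<bar>"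
    using dom[OF i(1)] by (simp add: mult_right_mono flip: sum_distrib_right)
  finally have "\<bar>x + A $$ (i, i)\<bar> \<le> A $$ (i, i)"
    using pos by (simp add: abs_mult)
  then show ?thesis by linarith
qed

text \<open>If the determinant were negative, the characteristic polynomial of \<open>- A\<close> would be negative
  at 0 and positive at infinity, hence have a positive root.\<close>

lemma det_nonneg_diag_dominant:
  fixes A :: "real mat"
  assumes A: "A \<in> carrier_mat n n"
    and dom: "\<And>i. i < n \<Longrightarrow> (\<Sum>j\<in>{..<n} - {i}. \<bar>A $$ (i, j)\<bar>) \<le> A $$ (i, i)"
  shows "0 \<le> det A"
proof (rule ccontr)
  assume neg: "\<not> 0 \<le> det A"
  let ?p = "char_poly (- A)"
  have mA: "- A \<in> carrier_mat n n" using A by simp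
  \<comment> \<open>The value at 0 is the determinant of -(-A); working with \<open>- A\<close>
    avoids a sign depending on \<open>n\<close>.\<close>
  have "poly ?p 0 = det A"
    unfolding char_poly_def
    by (rule poly_det_cong[of _ n]) (use A in \<open>auto simp: char_poly_matrix_def\<close>)
  moreover have "lead_coeff ?p = 1"
    using degree_monic_char_poly[OF mA] by simp
  then obtain t where "\<forall>y\<ge>t. 1 \<le> poly ?p y"
    using poly_pinfty_gt_lc[of ?p] by auto
  then have "1 \<le> poly ?p (max t 1)" by simp
  ultimately obtain x where "0 < x" "poly ?p x = 0"
    using poly_IVT_pos[of 0 "max t 1" ?p] neg
    by (metis less_max_iff_disj less_numeral_extra(1) not_le order_less_le_trans)
  then have "eigenvalue (- A) x"
    using eigenvalue_root_char_poly[OF mA] by simp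
  then show False
    using no_positive_eigenvalue_neg_diag_dominant[OF A dom] \<open>0 < x\<close> by force
qed

section \<open>The determinant of a Laplacian plus a constant matrix\<close>

lemma det_unit_column:
  fixes A :: "'a::comm_ring_1 mat"
  assumes A: "A \<in> carrier_mat n n" and k: "k < n"
    and col: "\<And>i. i < n \<Longrightarrow> i \<noteq> k \<Longrightarrow> A $$ (i, k) = 0"
  shows "det A = A $$ (k, k) * det (mat_delete A k k)"
proof -
  have "det A = (\<Sum>i<n. A $$ (i, k) * cofactor A i k)"
    by (rule laplace_expansion_column[OF A k])
  also have "\<dots> = (\<Sum>i\<in>{k}. A $$ (i, k) * cofactor A i k)"
    using k col by (intro sum.mono_neutral_right) auto
  finally show ?thesis
    by (simp add: cofactor_def flip: mult_2)
qed

lemma index_mult_mat_sum: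
  assumes "A \<in> carrier_mat n m" "B \<in> carrier_mat m q" "i < n" "j < q"
  shows "(A * B) $$ (i, j) = (\<Sum>l<m. A $$ (i, l) * B $$ (l, j))"
  using assms by (simp add: scalar_prod_def atLeast0LessThan)

text \<open>Adding all rows to row \<open>k\<close>, removing \<open>1/n\<close> of that row from the others, and adding all
  columns to column \<open>k\<close> turns \<open>L + x J\<close> into \<open>L\<close> outside row and column \<open>k\<close>.\<close>

lemma det_add_const_zero_sums:
  fixes L :: "'a::field_char_0 mat"
  assumes L: "L \<in> carrier_mat n n" and k: "k < n"
    and row: "\<And>i. i < n \<Longrightarrow> (\<Sum>j<n. L $$ (i, j)) = 0"
    and col: "\<And>j. j < n \<Longrightarrow> (\<Sum>i<n. L $$ (i, j)) = 0"
  shows "det (mat n n (\<lambda>(i, j). L $$ (i, j) + x)) = x * of_nat (n ^ 2) * det (mat_delete L k k)"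
proof -
  define M where "M = mat n n (\<lambda>(i, j). L $$ (i, j) + x)"
  \<comment> \<open>Multiplying by \<open>E\<close> on the left adds all rows to row
    \<open>k\<close>; its transpose on the right does the same for columns. Left multiplication by
    \<open>S\<close> subtracts 1/n of row \<open>k\<close> from the others.\<close>
  define E where "E = mat n n (\<lambda>(i, j). if i = k \<or> i = j then 1 else (0::'a))"
  define S where "S = mat n n (\<lambda>(i, j). if i = j then 1 else if j = k then - 1 / of_nat n else (0::'a))"
  have car: "M \<in> carrier_mat n n" "E \<in> carrier_mat n n" "S \<in> carrier_mat n n"
    by (simp_all add: M_def E_def S_def)
  have "mat_delete E k k = 1\<^sub>m (n - 1)"
    using k by (intro eq_matI) (auto simp: mat_delete_def E_def)
  then have det_E: "det E = 1"
    using det_unit_column[OF car(2) k] k by (simp add: E_def)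
  \<comment> \<open>In \<open>S\<close> it is row \<open>k\<close>, not column \<open>k\<close>,
    that vanishes off the diagonal, hence the transpose.\<close>
  have "mat_delete S\<^sup>T k k = 1\<^sub>m (n - 1)"
    using k by (intro eq_matI) (auto simp: mat_delete_def S_def)
  then have "det S\<^sup>T = 1"
    using det_unit_column[of "S\<^sup>T" n k] car(3) k by (simp add: S_def)
  then have det_S: "det S = 1"
    using det_transpose[OF car(3)] by simp
  \<comment> \<open>Row \<open>k\<close> becomes the constant \<open>n x\<close> because the columns
    of \<open>L\<close> sum to 0; 1/n of it is precisely the \<open>x\<close> to be removed
    elsewhere.\<close>
  have EM: "(E * M) $$ (i, j) = (if i = k then of_nat n * x else L $$ (i, j) + x)"
    if "i < n" "j < n" for i j
  proof -
    have "(E * M) $$ (i, j) = (\<Sum>l<n. if i = k \<or> i = l then L $$ (l, j) + x else 0)"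
      unfolding index_mult_mat_sum[OF car(2,1) that]
      using that by (intro sum.cong) (auto simp: E_def M_def)
    then show ?thesis
      using that col[OF that(2)] by (auto simp: sum.distrib)
  qed
  have carEM: "E * M \<in> carrier_mat n n" and carSEM: "S * (E * M) \<in> carrier_mat n n"
    using car by auto
  have SEM: "(S * (E * M)) $$ (i, j) = (if i = k then of_nat n * x else L $$ (i, j))"
    if "i < n" "j < n" for i j
  proof -
    have "(S * (E * M)) $$ (i, j) = (\<Sum>l<n. (if l = i then (E * M) $$ (l, j) else 0) +
        (if l = k then if i = k then 0 else - 1 / of_nat n * (E * M) $$ (l, j) else 0))"
      unfolding index_mult_mat_sum[OF car(3) carEM that]
      using that by (intro sum.cong) (auto simp: S_def)
    also have "\<dots> = (E * M) $$ (i, j) + (if i = k then 0 else - 1 / of_nat n * (E * M) $$ (k, j))"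
      using that k by (simp add: sum.distrib)
    finally show ?thesis
      using that k by (simp add: EM)
  qed
  define T where "T = S * (E * M) * E\<^sup>T"
  \<comment> \<open>Adding \<open>n\<close> columns with entry \<open>n x\<close> in row
    \<open>k\<close> gives the factor n^2; in the other rows the row sums of \<open>L\<close> leave
    0.\<close>
  have T: "T $$ (i, j) = (if j = k then (if i = k then x * of_nat (n ^ 2) else 0)
      else (S * (E * M)) $$ (i, j))" if "i < n" "j < n" for i j
  proof -
    have "T $$ (i, j) = (\<Sum>l<n. if j = k \<or> l = j then (S * (E * M)) $$ (i, l) else 0)"
      unfolding T_def index_mult_mat_sum[OF carSEM transpose_carrier_mat[THEN iffD2, OF car(2)] that]
      using that by (intro sum.cong) (auto simp: E_def)
    then show ?thesis
      using that k row[OF that(1)]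
      by (auto simp: SEM power2_eq_square)
  qed
  have carT: "T \<in> carrier_mat n n"
    unfolding T_def using car by auto
  have "det M = det S * (det E * det M) * det E\<^sup>T"
    using det_transpose[OF car(2)] det_E det_S by simp
  also have "\<dots> = det T"
    unfolding T_def det_mult[OF carSEM transpose_carrier_mat[THEN iffD2, OF car(2)]]
      det_mult[OF car(3) carEM] det_mult[OF car(2,1)] ..
  also have "\<dots> = x * of_nat (n ^ 2) * det (mat_delete T k k)"
    using det_unit_column[OF carT k] k by (simp add: T)
  also have "mat_delete T k k = mat_delete L k k"
    using L carT k by (intro eq_matI) (auto simp: mat_delete_def T SEM)
  finally show ?thesis by (simp add: M_def)
qed

section \<open>Block diagonalisation by characters\<close>

text \<open>Quotient and remainder by \<open>n\<close> name the block and the position in it. The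
  last block splits off as a four-block matrix with zero off-diagonal blocks.\<close>

lemma det_block_diagonal:
  fixes B :: "nat \<Rightarrow> nat \<Rightarrow> nat \<Rightarrow> 'a::idom"
  assumes n: "0 < n"
  shows "det (mat (d * n) (d * n)
      (\<lambda>(r, c). if r div n = c div n then B (r div n) (r mod n) (c mod n) else 0)) =
    (\<Prod>a<d. det (mat n n (\<lambda>(i, j). B a i j)))"
proof (induction d)
  case 0
  show ?case by simp
next
  case (Suc d)
  let ?M = "\<lambda>d. mat (d * n) (d * n)
      (\<lambda>(r, c). if r div n = c div n then B (r div n) (r mod n) (c mod n) else 0)"
  have small: "r div n < d" if "r < d * n" for r
    using that n by (simp add: div_less_iff_less_mult)
  have large: "r div n = d \<and> r mod n = r - d * n" if "d * n \<le> r" "r < Suc d * n" for r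
  proof -
    have "r = n * d + (r - d * n)" "r - d * n < n"
      using that by (simp_all add: mult.commute)
    then show ?thesis
      using div_mult_self2[of n "r - d * n" d] mod_mult_self2[of "r - d * n" n d] n
      by (metis add.commute div_less mod_less add_0 less_not_refl)
  qed
  have "?M (Suc d) = four_block_mat (?M d) (0\<^sub>m (d * n) n) (0\<^sub>m n (d * n)) (mat n n (\<lambda>(i, j). B d i j))"
    (is "_ = ?R")
  proof (rule eq_matI)
    show "dim_row (?M (Suc d)) = dim_row ?R" "dim_col (?M (Suc d)) = dim_col ?R"
      by (simp_all add: add.commute)
    fix r c assume "r < dim_row ?R" "c < dim_col ?R"
    then have rc: "r < Suc d * n" "c < Suc d * n" by (simp_all add: add.commute)
    show "?M (Suc d) $$ (r, c) = ?R $$ (r, c)"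
      using rc small[of r] small[of c] large[of r] large[of c]
      by (cases "r < d * n"; cases "c < d * n") (simp_all add: index_mat_four_block not_less)
  qed
  then show ?case
    by (simp add: det_four_block_mat_lower_left_zero[of _ "d * n" _ n] Suc)
qed

lemma sum_div_mod:
  fixes f :: "nat \<Rightarrow> nat \<Rightarrow> 'a::comm_monoid_add"
  assumes "0 < n"
  shows "(\<Sum>c<d * n. f (c div n) (c mod n)) = (\<Sum>a<d. \<Sum>j<n. f a j)"
proof -
  have "(\<Sum>c<d * n. f (c div n) (c mod n)) = (\<Sum>a<d. \<Sum>c\<in>{a * n..<a * n + n}. f (c div n) (c mod n))"
    by (rule sum.nat_group[symmetric])
  also have "\<dots> = (\<Sum>a<d. \<Sum>j<n. f a j)"
  proof (rule sum.cong[OF refl])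
    fix a
    have "(\<Sum>c\<in>{a * n..<a * n + n}. f (c div n) (c mod n)) =
        (\<Sum>j\<in>{0..<n}. f ((j + a * n) div n) ((j + a * n) mod n))"
      using sum.shift_bounds_nat_ivl[of "\<lambda>c. f (c div n) (c mod n)" 0 "a * n" n]
      by (simp add: add.commute)
    also have "\<dots> = (\<Sum>j\<in>{0..<n}. f a j)"
      using assms by (intro sum.cong) auto
    finally show "(\<Sum>c\<in>{a * n..<a * n + n}. f (c div n) (c mod n)) = (\<Sum>j<n. f a j)"
      by (simp add: atLeast0LessThan)
  qed
  finally show ?thesis .
qed

text \<open>Passing through the underlying sets allows \<open>ws\<close> to list the product in any
  order.\<close>

lemma sum_enum_product:
  fixes f :: "'v \<Rightarrow> 'g::finite \<Rightarrow> 'a::comm_monoid_add"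
  assumes "distinct vs" "distinct ws" "set ws = set vs \<times> UNIV"
  shows "(\<Sum>r<length ws. f (fst (ws ! r)) (snd (ws ! r))) = (\<Sum>i<length vs. \<Sum>g\<in>UNIV. f (vs ! i) g)"
proof -
  have "(\<Sum>r<length ws. f (fst (ws ! r)) (snd (ws ! r))) = (\<Sum>p\<in>set ws. f (fst p) (snd p))"
    by (rule sum.reindex_bij_betw[OF bij_betw_nth[OF assms(2)], of "{..<length ws}" "set ws"]) auto
  also have "\<dots> = (\<Sum>v\<in>set vs. \<Sum>g\<in>UNIV. f v g)"
    by (simp add: assms(3) sum.cartesian_product case_prod_beta)
  also have "\<dots> = (\<Sum>i<length vs. \<Sum>g\<in>UNIV. f (vs ! i) g)"
    by (rule sum.reindex_bij_betw[OF bij_betw_nth[OF assms(1)], symmetric]) auto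
  finally show ?thesis .
qed

text \<open>The columns of \<open>F\<close> are the functions supported on one fibre coordinate \<open>vs ! j\<close> and equal to a
  character there; they are ordered so that the column \<open>a * n + j\<close> belongs to the \<open>a\<close>-th character.\<close>

lemma det_translation_invariant:
  fixes m :: "'v \<Rightarrow> 'v \<Rightarrow> 'g::{finite, ab_group_add} \<Rightarrow> complex"
  assumes vs: "distinct vs" and ws: "distinct ws" "set ws = set vs \<times> UNIV" and ne: "vs \<noteq> []"
  shows "det (mat (length ws) (length ws)
      (\<lambda>(r, c). m (fst (ws ! r)) (fst (ws ! c)) (snd (ws ! c) - snd (ws ! r)))) =
    (\<Prod>\<chi>\<in>characters. det (mat (length vs) (length vs)
      (\<lambda>(i, j). \<Sum>g\<in>UNIV. m (vs ! i) (vs ! j) g * \<chi> g)))"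
proof -
  define n d where "n = length vs" and "d = card (UNIV :: 'g set)"
  have n: "0 < n" using ne by (simp add: n_def)
  have d: "0 < d" by (simp add: d_def card_gt_0_iff)
  have len: "length ws = d * n"
    using distinct_card[OF ws(1)] distinct_card[OF vs]
    by (simp add: ws(2) card_cartesian_product n_def d_def mult.commute)
  obtain ch where ch: "bij_betw ch {..<d} (characters :: ('g \<Rightarrow> complex) set)"
    using ex_bij_betw_nat_finite[OF finite_characters] card_characters
    by (metis atLeast0LessThan d_def)
  have ch_in: "ch a \<in> characters" if "a < d" for a
    using ch that by (auto simp: bij_betw_def)
  have ch_inj: "ch a = ch b \<longleftrightarrow> a = b" if "a < d" "b < d" for a b
    using ch that by (auto simp: bij_betw_def inj_on_def)
  have nth_eq: "vs ! i = vs ! j \<longleftrightarrow> i = j" if "i < n" "j < n" for i j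
    using vs that by (simp add: nth_eq_iff_index_eq n_def)
  define M where "M = mat (d * n) (d * n)
    (\<lambda>(r, c). m (fst (ws ! r)) (fst (ws ! c)) (snd (ws ! c) - snd (ws ! r)))"
  \<comment> \<open>Rows follow the arbitrary order of \<open>ws\<close>, columns the block order,
    so \<open>F\<close> changes the basis and sorts the indices at once.\<close>
  define F where "F = mat (d * n) (d * n)
    (\<lambda>(r, c). if fst (ws ! r) = vs ! (c mod n) then ch (c div n) (snd (ws ! r)) else 0)"
  \<comment> \<open>By orthogonality this is \<open>d\<close> times the inverse of \<open>F\<close>;
    it only serves to show that \<open>det F\<close> is nonzero.\<close>
  define F' where "F' = mat (d * n) (d * n)
    (\<lambda>(c, r). if fst (ws ! r) = vs ! (c mod n) then ch (c div n) (- snd (ws ! r)) else 0)"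
  define b where "b a i j = (\<Sum>g\<in>UNIV. m (vs ! i) (vs ! j) g * ch a g)" for a i j
  define B where "B = mat (d * n) (d * n)
    (\<lambda>(r, c). if r div n = c div n then b (r div n) (r mod n) (c mod n) else 0)"
  have car: "M \<in> carrier_mat (d * n) (d * n)" "F \<in> carrier_mat (d * n) (d * n)"
      "F' \<in> carrier_mat (d * n) (d * n)" "B \<in> carrier_mat (d * n) (d * n)"
    by (simp_all add: M_def F_def F'_def B_def)
  have dm: "c div n < d" "c mod n < n" if "c < d * n" for c
    using that n by (simp_all add: div_less_iff_less_mult)
  have sum_ws: "(\<Sum>r<d * n. f (fst (ws ! r)) (snd (ws ! r))) = (\<Sum>i<n. \<Sum>g\<in>UNIV. f (vs ! i) g)"
    for f :: "'v \<Rightarrow> 'g \<Rightarrow> complex"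
    using sum_enum_product[OF vs ws, of f] by (simp add: len n_def)
  have "F' * F = of_nat d \<cdot>\<^sub>m 1\<^sub>m (d * n)"
  proof (rule eq_matI)
    fix c e assume "c < dim_row (of_nat d \<cdot>\<^sub>m (1\<^sub>m (d * n) :: complex mat))"
      "e < dim_col (of_nat d \<cdot>\<^sub>m (1\<^sub>m (d * n) :: complex mat))"
    then have ce: "c < d * n" "e < d * n" by simp_all
    define a j a' j' where "a = c div n" and "j = c mod n" and "a' = e div n" and "j' = e mod n"
    have aj: "a < d" "j < n" "a' < d" "j' < n"
      using dm ce by (simp_all add: a_def j_def a'_def j'_def)
    have eq: "c = e \<longleftrightarrow> a = a' \<and> j = j'"
      unfolding a_def j_def a'_def j'_def by (metis div_mult_mod_eq)
    let ?f = "\<lambda>v g. if v = vs ! j \<and> v = vs ! j' then ch a (- g) * ch a' g else 0"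
    have "(F' * F) $$ (c, e) = (\<Sum>r<d * n. ?f (fst (ws ! r)) (snd (ws ! r)))"
      unfolding index_mult_mat_sum[OF car(3,2) ce]
      using ce by (intro sum.cong) (auto simp: F_def F'_def a_def j_def a'_def j'_def)
    also have "\<dots> = (\<Sum>i<n. \<Sum>g\<in>UNIV. ?f (vs ! i) g)"
      by (rule sum_ws[of ?f])
    also have "\<dots> = (\<Sum>i<n. if i = j then if j = j'
        then (\<Sum>g\<in>UNIV. ch a (- g) * ch a' g) else 0 else 0)"
      using aj by (intro sum.cong) (auto simp: nth_eq)
    also have "\<dots> = (if j = j' then (\<Sum>g\<in>UNIV. ch a (- g) * ch a' g) else 0)"
      using aj(2) by simp
    also have "\<dots> = (if c = e then of_nat d else 0)"
      unfolding character_orthogonality[OF ch_in[OF aj(1)] ch_in[OF aj(3)]] ch_inj[OF aj(1,3)] eq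
      by (simp add: d_def)
    also have "\<dots> = (of_nat d \<cdot>\<^sub>m 1\<^sub>m (d * n)) $$ (c, e)"
      using ce by simp
    finally show "(F' * F) $$ (c, e) = (of_nat d \<cdot>\<^sub>m 1\<^sub>m (d * n)) $$ (c, e)" .
  qed (use car in auto)
  then have "det F' * det F = of_nat d ^ (d * n)"
    using det_mult[OF car(3,2)] by simp
  then have "det F \<noteq> 0"
    using d by auto
  have "M * F = F * B"
  proof (rule eq_matI)
    fix r c assume "r < dim_row (F * B)" "c < dim_col (F * B)"
    then have rc: "r < d * n" "c < d * n" using car by auto
    define a j where "a = c div n" and "j = c mod n"
    have aj: "a < d" "j < n"
      using dm rc by (simp_all add: a_def j_def)
    obtain u g where ug: "ws ! r = (u, g)" by fastforce
    have "ws ! r \<in> set vs \<times> UNIV"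
      using rc(1) len ws(2) nth_mem by metis
    then obtain i where i: "i < n" "u = vs ! i"
      by (auto simp: ug in_set_conv_nth n_def)
    have ch_add: "ch a (h + g) = ch a h * ch a g" for h
      using ch_in[OF aj(1)] by (simp add: characters_def)
    let ?f = "\<lambda>v h. if v = vs ! j then m u v (h - g) * ch a h else 0"
    have "(M * F) $$ (r, c) = (\<Sum>q<d * n. ?f (fst (ws ! q)) (snd (ws ! q)))"
      unfolding index_mult_mat_sum[OF car(1,2) rc]
      using rc by (intro sum.cong) (auto simp: M_def F_def ug a_def j_def)
    also have "\<dots> = (\<Sum>k<n. \<Sum>h\<in>UNIV. ?f (vs ! k) h)"
      by (rule sum_ws[of ?f])
    also have "\<dots> = (\<Sum>k<n. if k = j then (\<Sum>h\<in>UNIV. m u (vs ! j) (h - g) * ch a h) else 0)"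
      using aj by (intro sum.cong) (auto simp: nth_eq)
    also have "\<dots> = (\<Sum>h\<in>UNIV. m u (vs ! j) (h - g) * ch a h)"
      using aj by simp
    \<comment> \<open>Translation invariance enters here: the shift by \<open>g\<close> moves from
      \<open>m\<close> to the character, which turns it into the scalar
      \<open>ch a g\<close>.\<close>
    also have "\<dots> = (\<Sum>h\<in>UNIV. m u (vs ! j) h * ch a (h + g))"
      by (rule sum.reindex_bij_witness[of _ "\<lambda>h. h + g" "\<lambda>h. h - g"]) auto
    also have "\<dots> = ch a g * b a i j"
      unfolding b_def i(2) ch_add by (simp add: sum_distrib_left mult_ac)
    finally have MF: "(M * F) $$ (r, c) = ch a g * b a i j" .
    let ?h = "\<lambda>a' k. if a' = a then if k = i then ch a g * b a i j else 0 else 0"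
    have "(F * B) $$ (r, c) = (\<Sum>q<d * n. ?h (q div n) (q mod n))"
      unfolding index_mult_mat_sum[OF car(2,4) rc]
      using rc dm i by (intro sum.cong) (auto simp: F_def B_def ug nth_eq a_def j_def)
    also have "\<dots> = (\<Sum>a'<d. \<Sum>k<n. ?h a' k)"
      by (rule sum_div_mod[OF n, of ?h])
    also have "\<dots> = (\<Sum>a'<d. if a' = a then (\<Sum>k<n. if k = i then ch a g * b a i j else 0) else 0)"
      by (intro sum.cong) auto
    also have "\<dots> = ch a g * b a i j"
      using aj i(1) by simp
    finally show "(M * F) $$ (r, c) = (F * B) $$ (r, c)"
      using MF by simp
  qed (use car in auto)
  then have "det M * det F = det B * det F"
    using det_mult[OF car(1,2)] det_mult[OF car(2,4)] by (metis mult.commute)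
  then have "det M = det B"
    using \<open>det F \<noteq> 0\<close> by simp
  also have "\<dots> = (\<Prod>a<d. det (mat n n (\<lambda>(i, j). b a i j)))"
    unfolding B_def by (rule det_block_diagonal[OF n])
  also have "\<dots> = (\<Prod>\<chi>\<in>characters. det (mat n n (\<lambda>(i, j). \<Sum>g\<in>UNIV. m (vs ! i) (vs ! j) g * \<chi> g)))"
    unfolding b_def
    by (rule prod.reindex_bij_betw[OF ch, of "\<lambda>\<chi>. det (mat n n (\<lambda>(i, j). \<Sum>g\<in>UNIV. m (vs ! i) (vs ! j) g * \<chi> g))"])
  finally show ?thesis
    by (simp add: M_def len n_def)
qed

section \<open>Graph Laplacians and voltage covers\<close>

lemma char_extend_eq_sum:
  fixes x :: "'g::{finite, ab_group_add} \<Rightarrow>\<^sub>0 int"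
  shows "char_extend \<chi> x = (\<Sum>g\<in>UNIV. of_int (Poly_Mapping.lookup x g) * \<chi> g)"
  unfolding char_extend_def by (rule sum.mono_neutral_left) (auto simp: in_keys_iff)

text \<open>This allows a character to be moved inside the determinant defining
  \<open>stickelberger\<close>. For products, the convolution is written with an indicator of k = g
  + h, and summing over \<open>k\<close> innermost removes it.\<close>

lemma comm_ring_hom_char_extend:
  fixes \<chi> :: "'g::{finite, ab_group_add} \<Rightarrow> complex"
  assumes \<chi>: "\<chi> \<in> characters"
  shows "comm_ring_hom (char_extend \<chi>)"
proof
  show "char_extend \<chi> 0 = 0" by (simp add: char_extend_eq_sum)
  show "char_extend \<chi> 1 = 1"
    using character_zero[OF \<chi>]
    by (simp add: char_extend_eq_sum lookup_one when_def if_distrib if_distribR cong: if_cong)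
  fix x y :: "'g \<Rightarrow>\<^sub>0 int"
  show "char_extend \<chi> (x + y) = char_extend \<chi> x + char_extend \<chi> y"
    by (simp add: char_extend_eq_sum lookup_add distrib_right sum.distrib)
  have mult: "Poly_Mapping.lookup (x * y) k =
      (\<Sum>g\<in>UNIV. \<Sum>h\<in>UNIV. if k = g + h then Poly_Mapping.lookup x g * Poly_Mapping.lookup y h else 0)"
    for k
    unfolding lookup_mult
    by (simp add: Sum_any.expand_superset[of UNIV] when_def sum_distrib_left if_distrib cong: if_cong)
  have "char_extend \<chi> (x * y) = (\<Sum>k\<in>UNIV. \<Sum>g\<in>UNIV. \<Sum>h\<in>UNIV.
      if k = g + h then of_int (Poly_Mapping.lookup x g * Poly_Mapping.lookup y h) * \<chi> k else 0)"
    unfolding char_extend_eq_sum mult of_int_sum sum_distrib_right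
    by (intro sum.cong) auto
  also have "\<dots> = (\<Sum>g\<in>UNIV. \<Sum>k\<in>UNIV. \<Sum>h\<in>UNIV.
      if k = g + h then of_int (Poly_Mapping.lookup x g * Poly_Mapping.lookup y h) * \<chi> k else 0)"
    by (rule sum.swap)
  also have "\<dots> = (\<Sum>g\<in>UNIV. \<Sum>h\<in>UNIV. \<Sum>k\<in>UNIV.
      if k = g + h then of_int (Poly_Mapping.lookup x g * Poly_Mapping.lookup y h) * \<chi> k else 0)"
    by (rule sum.cong[OF refl], rule sum.swap)
  also have "\<dots> = (\<Sum>g\<in>UNIV. \<Sum>h\<in>UNIV.
      of_int (Poly_Mapping.lookup x g * Poly_Mapping.lookup y h) * \<chi> (g + h))"
    by (intro sum.cong refl) simp
  also have "\<dots> = char_extend \<chi> x * char_extend \<chi> y"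
    unfolding char_extend_eq_sum sum_product
    using \<chi> by (intro sum.cong refl) (simp add: characters_def mult_ac)
  finally show "char_extend \<chi> (x * y) = char_extend \<chi> x * char_extend \<chi> y" .
qed

lemma char_extend_single:
  fixes \<chi> :: "'g::{finite, ab_group_add} \<Rightarrow> complex"
  shows "char_extend \<chi> (Poly_Mapping.single g k) = of_int k * \<chi> g"
  by (cases "k = 0") (simp_all add: char_extend_def)

lemma char_extend_of_nat:
  fixes \<chi> :: "'g::{finite, ab_group_add} \<Rightarrow> complex"
  assumes "\<chi> \<in> characters"
  shows "char_extend \<chi> (of_nat k) = of_nat k"
  using char_extend_single[of \<chi> 0 "int k"] character_zero[OF assms]
  by simp

lemma char_extend_stickelberger:
  fixes \<chi> :: "'g::{finite, ab_group_add} \<Rightarrow> complex"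
  assumes "\<chi> \<in> characters"
  shows "char_extend \<chi> (stickelberger X \<alpha> vs) = det (mat (length vs) (length vs)
    (\<lambda>(i, j). (if i = j then of_nat (out_degree (with_proj X) (vs ! i)) else 0) -
      (if (vs ! i, vs ! j) \<in> parcs X then \<chi> (\<alpha> (vs ! i) (vs ! j)) else 0)))"
proof -
  interpret comm_ring_hom "char_extend \<chi>"
    by (rule comm_ring_hom_char_extend[OF assms])
  show ?thesis
    unfolding stickelberger_def hom_det[symmetric]
    by (intro arg_cong[of _ _ det] eq_matI)
      (auto simp: degree_mat_def voltage_adjacency_mat_def hom_distribs char_extend_single
        char_extend_of_nat[OF assms])
qed

section \<open>Laplacians and the order of the Jacobian\<close>

text \<open>Zero row sums and nonpositive off-diagonal entries make each diagonal entry equal to the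
  sum of the absolute values of the others in its row; deleting a column can only lower that
  sum.\<close>

lemma det_reduced_laplacian_nonneg:
  fixes L :: "int mat"
  assumes L: "L \<in> carrier_mat n n" and k: "k < n"
    and offdiag: "\<And>i j. i < n \<Longrightarrow> j < n \<Longrightarrow> i \<noteq> j \<Longrightarrow> L $$ (i, j) \<le> 0"
    and row: "\<And>i. i < n \<Longrightarrow> (\<Sum>j<n. L $$ (i, j)) = 0"
  shows "0 \<le> det (mat_delete L k k)"
proof -
  \<comment> \<open>The index shift of \<open>mat_delete\<close>, whose image omits
    \<open>k\<close>.\<close>
  define s where "s i = (if i < k then i else Suc i)" for i
  have entry: "mat_delete L k k $$ (i, j) = L $$ (s i, s j)" if "i < n - 1" "j < n - 1" for i j
    using that L by (simp add: mat_delete_def s_def)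
  have s_inj: "inj s"
    by (auto simp: inj_def s_def split: if_splits)
  have s_less: "s i < n" if "i < n - 1" for i
    using that k by (auto simp: s_def)
  let ?A = "map_mat real_of_int (mat_delete L k k)"
  have car: "?A \<in> carrier_mat (n - 1) (n - 1)"
    using mat_delete_carrier[OF L] by simp
  have "0 \<le> det ?A"
  proof (rule det_nonneg_diag_dominant[OF car])
    fix i assume i: "i < n - 1"
    have A: "?A $$ (i, j) = real_of_int (L $$ (s i, s j))" if "j < n - 1" for j
      using that i L entry by simp
    have "(\<Sum>j\<in>{..<n - 1} - {i}. \<bar>?A $$ (i, j)\<bar>) = (\<Sum>j\<in>{..<n - 1} - {i}. \<bar>real_of_int (L $$ (s i, s j))\<bar>)"
      by (intro sum.cong refl) (simp add: A)
    also have "\<dots> = (\<Sum>j\<in>s ` ({..<n - 1} - {i}). \<bar>real_of_int (L $$ (s i, j))\<bar>)"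
      using s_inj by (simp add: sum.reindex inj_on_subset)
    also have "\<dots> \<le> (\<Sum>j\<in>{..<n} - {s i}. \<bar>real_of_int (L $$ (s i, j))\<bar>)"
      using s_less s_inj by (intro sum_mono2) (auto simp: inj_eq)
    also have "\<dots> = (\<Sum>j\<in>{..<n} - {s i}. - real_of_int (L $$ (s i, j)))"
      using offdiag s_less[OF i] by (intro sum.cong refl) auto
    also have "\<dots> = real_of_int (L $$ (s i, s i)) - real_of_int (\<Sum>j<n. L $$ (s i, j))"
      using s_less[OF i] by (subst sum.remove[of "{..<n}" "s i"]) (simp_all add: sum_negf)
    also have "\<dots> = ?A $$ (i, i)"
      using row[OF s_less[OF i]] A[OF i] by simp
    finally show "(\<Sum>j\<in>{..<n - 1} - {i}. \<bar>?A $$ (i, j)\<bar>) \<le> ?A $$ (i, i)" .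
  qed
  then show ?thesis by simp
qed

lemma laplacian_carrier: "laplacian X vs \<in> carrier_mat (length vs) (length vs)"
  by (rule carrier_matI) (simp_all add: laplacian_def degree_mat_def adjacency_mat_def)

lemma laplacian_index:
  assumes "i < length vs" "j < length vs"
  shows "laplacian X vs $$ (i, j) = (if i = j then int (out_degree (with_proj X) (vs ! i)) else 0) -
    (if (vs ! i, vs ! j) \<in> parcs X then 1 else 0)"
  using assms by (simp add: laplacian_def degree_mat_def adjacency_mat_def)

lemma pair_graph_sym:
  assumes "pair_graph X" "(u, v) \<in> parcs X"
  shows "(v, u) \<in> parcs X"
proof -
  interpret pair_graph X by fact
  show ?thesis
    using pair_sym_arcs assms(2) by (force simp: symmetric_conv)
qed

lemma out_degree_eq_sum:
  assumes "pair_graph X" and vs: "vertex_enum vs X"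
  shows "int (out_degree (with_proj X) u) = (\<Sum>j<length vs. if (u, vs ! j) \<in> parcs X then 1 else 0)"
proof -
  interpret pair_graph X by fact
  have "out_arcs (with_proj X) u = Pair u ` {v \<in> pverts X. (u, v) \<in> parcs X}"
    using in_arcsD2 by (auto simp: out_arcs_def)
  then have "int (out_degree (with_proj X) u) = int (card {v \<in> pverts X. (u, v) \<in> parcs X})"
    by (simp add: out_degree_def card_image inj_on_def)
  also have "\<dots> = (\<Sum>v\<in>pverts X. if (u, v) \<in> parcs X then 1 else 0)"
    using pair_finite_verts by (simp add: sum.If_cases Int_def)
  also have "\<dots> = (\<Sum>j<length vs. if (u, vs ! j) \<in> parcs X then 1 else 0)"
    using vs unfolding vertex_enum_def
    by (intro sum.reindex_bij_betw[OF bij_betw_nth, symmetric]) auto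
  finally show ?thesis .
qed

lemma laplacian_row_sum:
  assumes "pair_graph X" "vertex_enum vs X" "i < length vs"
  shows "(\<Sum>j<length vs. laplacian X vs $$ (i, j)) = 0"
proof -
  have "(\<Sum>j<length vs. laplacian X vs $$ (i, j)) =
      (\<Sum>j<length vs. (if i = j then int (out_degree (with_proj X) (vs ! i)) else 0) -
        (if (vs ! i, vs ! j) \<in> parcs X then 1 else 0))"
    using assms(3) by (intro sum.cong refl laplacian_index) auto
  then show ?thesis
    using assms(3) out_degree_eq_sum[OF assms(1,2)] by (simp add: sum_subtractf)
qed

lemma laplacian_sym:
  assumes "pair_graph X" "i < length vs" "j < length vs"
  shows "laplacian X vs $$ (i, j) = laplacian X vs $$ (j, i)"
  using assms pair_graph_sym[OF assms(1)] by (auto simp: laplacian_index)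

lemma laplacian_offdiag:
  assumes "i < length vs" "j < length vs" "i \<noteq> j"
  shows "laplacian X vs $$ (i, j) \<le> 0"
  using assms by (simp add: laplacian_index)

lemma order_jacobian:
  assumes "pair_graph X" "vertex_enum vs X" "k < length vs"
  shows "int (Coset.order (jacobian X vs k)) = det (mat_delete (laplacian X vs) k k)"
proof -
  have "0 \<le> det (mat_delete (laplacian X vs) k k)"
    using laplacian_carrier assms(3) laplacian_offdiag laplacian_row_sum[OF assms(1,2)]
    by (rule det_reduced_laplacian_nonneg)
  then show ?thesis
    unfolding jacobian_def order_cokernel[OF mat_delete_carrier[OF laplacian_carrier]] by simp
qed

text \<open>Used with \<open>x = 1\<close> for the derived graph and \<open>x = d\<close> for the
  base graph. The passage to complex entries permits the division by \<open>n\<close> in the row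
  operations.\<close>

lemma det_laplacian_add_const:
  assumes "pair_graph X" "vertex_enum vs X" "k < length vs"
  shows "det (mat (length vs) (length vs) (\<lambda>(i, j). complex_of_int (laplacian X vs $$ (i, j)) + x)) =
    x * of_nat (length vs ^ 2) * of_nat (Coset.order (jacobian X vs k))"
proof -
  let ?n = "length vs"
  let ?L = "map_mat complex_of_int (laplacian X vs)"
  note car = laplacian_carrier[of X vs]
  have L: "?L \<in> carrier_mat ?n ?n" using car by simp
  have index: "?L $$ (i, j) = of_int (laplacian X vs $$ (i, j))" if "i < ?n" "j < ?n" for i j
    using that car by simp
  have row: "(\<Sum>j<?n. ?L $$ (i, j)) = 0" if "i < ?n" for i
  proof -
    have "(\<Sum>j<?n. ?L $$ (i, j)) = of_int (\<Sum>j<?n. laplacian X vs $$ (i, j))"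
      unfolding of_int_sum using that by (intro sum.cong refl index) auto
    then show ?thesis
      using laplacian_row_sum[OF assms(1,2) that] by simp
  qed
  have col: "(\<Sum>i<?n. ?L $$ (i, j)) = 0" if "j < ?n" for j
  proof -
    have "(\<Sum>i<?n. ?L $$ (i, j)) = (\<Sum>i<?n. ?L $$ (j, i))"
      using that laplacian_sym[OF assms(1)] by (intro sum.cong refl) (simp add: index)
    then show ?thesis using row[OF that] by simp
  qed
  have "mat ?n ?n (\<lambda>(i, j). complex_of_int (laplacian X vs $$ (i, j)) + x) =
      mat ?n ?n (\<lambda>(i, j). ?L $$ (i, j) + x)"
    by (intro eq_matI) (auto simp: index)
  moreover have "mat_delete ?L k k = map_mat complex_of_int (mat_delete (laplacian X vs) k k)"
    using car by (intro eq_matI) (auto simp: mat_delete_def)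
  moreover have "complex_of_int (det (mat_delete (laplacian X vs) k k)) =
      of_nat (Coset.order (jacobian X vs k))"
    unfolding order_jacobian[OF assms, symmetric] by simp
  ultimately show ?thesis
    using det_add_const_zero_sums[OF L assms(3) row col, of x] by simp
qed

section \<open>The derived graph\<close>

text \<open>The voltage of a reversed arc is the negative, so the lift of the reversed arc leads
  back to the starting point; loops are excluded by the first coordinates.\<close>

lemma pair_graph_derived_graph:
  fixes \<alpha> :: "'v \<Rightarrow> 'v \<Rightarrow> 'g::{finite, ab_group_add}"
  assumes "pair_graph X" and \<alpha>: "voltage_assignment X \<alpha>"
  shows "pair_graph (derived_graph X \<alpha>)"
proof -
  interpret pair_graph X by fact
  let ?Y = "derived_graph X \<alpha>"
  have arcs: "((u, g), (v, h)) \<in> parcs ?Y \<longleftrightarrow> (u, v) \<in> parcs X \<and> h = g + \<alpha> u v" for u g v h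
    by (auto simp: derived_graph_def)
  have verts: "pverts ?Y = pverts X \<times> UNIV"
    by (simp add: derived_graph_def)
  have sub: "parcs ?Y \<subseteq> pverts ?Y \<times> pverts ?Y"
    using in_arcsD1 in_arcsD2 by (auto simp: verts derived_graph_def)
  show ?thesis
  proof
    show "finite (pverts ?Y)"
      using pair_finite_verts by (simp add: verts)
    then show "finite (parcs ?Y)"
      using sub by (meson finite_SigmaI finite_subset)
    show "symmetric (with_proj ?Y)"
      unfolding symmetric_conv
    proof
      fix e assume "e \<in> arcs (with_proj ?Y)"
      then obtain u g v where e: "e = ((u, g), (v, g + \<alpha> u v))" "(u, v) \<in> parcs X"
        by (auto simp: derived_graph_def)
      have "((v, g + \<alpha> u v), (u, g)) \<in> parcs ?Y"
        using e(2) \<alpha> pair_graph_sym[OF assms(1) e(2)] by (auto simp: arcs voltage_assignment_def)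
      then show "\<exists>e'\<in>arcs (with_proj ?Y). tail (with_proj ?Y) e = head (with_proj ?Y) e' \<and>
          head (with_proj ?Y) e = tail (with_proj ?Y) e'"
        unfolding e(1) by (intro bexI[of _ "((v, g + \<alpha> u v), (u, g))"]) auto
    qed
    fix e assume e: "e \<in> parcs ?Y"
    then show "fst e \<in> pverts ?Y" "snd e \<in> pverts ?Y"
      using sub by auto
    show "fst e \<noteq> snd e"
      using e pair_no_loops by (fastforce simp: derived_graph_def)
  qed
qed

text \<open>Each arc leaving \<open>u\<close> has exactly one lift starting at
  \<open>(u, g)\<close>.\<close>

lemma out_degree_derived_graph:
  "out_degree (with_proj (derived_graph X \<alpha>)) (u, g) = out_degree (with_proj X) u"
proof -
  have "out_arcs (with_proj (derived_graph X \<alpha>)) (u, g) =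
      (\<lambda>(u, v). ((u, g), (v, g + \<alpha> u v))) ` out_arcs (with_proj X) u"
    by (auto simp: out_arcs_def derived_graph_def image_iff)
  then show ?thesis
    by (simp add: out_degree_def card_image inj_on_def case_prod_beta prod_eq_iff)
qed

section \<open>Comparison of the determinants\<close>

theorem theorem2:
  fixes X :: "'v pair_pre_digraph"
    and \<alpha> :: "'v \<Rightarrow> 'v \<Rightarrow> 'g::{finite, ab_group_add}"
    and vs :: "'v list" and ws :: "('v \<times> 'g) list"
    and k l d :: nat
  assumes "pair_graph X"
    and "Digraph_Component.connected (with_proj X)"
    and "card (edges X) \<noteq> card (pverts X)"
    and "d = card (UNIV :: 'g set)"
    and "voltage_assignment X \<alpha>"
    and "Digraph_Component.connected (with_proj (derived_graph X \<alpha>))"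
    and "vertex_enum vs X" and "k < length vs"
    and "vertex_enum ws (derived_graph X \<alpha>)" and "l < length ws"
  shows "(of_nat (Coset.order (jacobian (derived_graph X \<alpha>) ws l)) :: complex) =
           1 / of_nat d * of_nat (Coset.order (jacobian X vs k)) *
           (\<Prod>\<chi> \<in> characters - {principal_character}. char_extend \<chi> (stickelberger X \<alpha> vs))"
proof -
  let ?Y = "derived_graph X \<alpha>"
  define n where "n = length vs"
  have n: "0 < n" using assms(8) unfolding n_def by linarith
  have d: "0 < d" by (simp add: assms(4) card_gt_0_iff)
  have vs: "distinct vs" and ws: "distinct ws" "set ws = set vs \<times> UNIV"
    using assms(7,9) by (auto simp: vertex_enum_def derived_graph_def)
  have len: "length ws = n * d"
    using distinct_card[OF ws(1)] distinct_card[OF vs]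
    by (simp add: ws(2) card_cartesian_product n_def assms(4))
  \<comment> \<open>The entry of the Laplacian of \<open>Y\<close> plus \<open>J\<close> between
    fibres over \<open>u\<close> and \<open>v\<close>, as a function of the difference
    \<open>g\<close> of the group coordinates; the final 1 comes from \<open>J\<close>.\<close>
  define m where "m u v g = (if u = v \<and> g = 0 then of_nat (out_degree (with_proj X) u) else 0) -
    (if (u, v) \<in> parcs X \<and> g = \<alpha> u v then 1 else 0) + (1::complex)" for u v g
  define b where "b \<chi> = mat n n (\<lambda>(i, j). \<Sum>g\<in>UNIV. m (vs ! i) (vs ! j) g * \<chi> g)" for \<chi>
  \<comment> \<open>The degree term sits at \<open>g = 0\<close>, where \<chi> is 1, the arc term at
    the voltage, and the constant 1 contributes the full character sum.\<close>
  have b_index: "(\<Sum>g\<in>UNIV. m (vs ! i) (vs ! j) g * \<chi> g) =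
      ((if i = j then of_nat (out_degree (with_proj X) (vs ! i)) else 0) -
        (if (vs ! i, vs ! j) \<in> parcs X then \<chi> (\<alpha> (vs ! i) (vs ! j)) else 0)) +
      (if \<chi> = principal_character then of_nat d else 0)"
    if "\<chi> \<in> characters" "i < n" "j < n" for \<chi> i j
  proof -
    have "vs ! i = vs ! j \<longleftrightarrow> i = j"
      using vs that by (simp add: nth_eq_iff_index_eq n_def)
    then have "(\<Sum>g\<in>UNIV. m (vs ! i) (vs ! j) g * \<chi> g) =
        (\<Sum>g\<in>UNIV. (if g = 0 then if i = j then of_nat (out_degree (with_proj X) (vs ! i)) * \<chi> 0 else 0 else 0) -
          (if g = \<alpha> (vs ! i) (vs ! j) then if (vs ! i, vs ! j) \<in> parcs X then \<chi> (\<alpha> (vs ! i) (vs ! j)) else 0 else 0) +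
          \<chi> g)"
      by (intro sum.cong refl) (auto simp: m_def algebra_simps)
    then show ?thesis
      using that(1) by (simp add: sum.distrib sum_subtractf sum_character character_zero assms(4))
  qed
  have one: "principal_character g = 1" for g :: 'g
    by (simp add: principal_character_def)
  have principal: "det (b principal_character) =
      of_nat d * of_nat (n ^ 2) * of_nat (Coset.order (jacobian X vs k))"
  proof -
    have "b principal_character = mat n n (\<lambda>(i, j). complex_of_int (laplacian X vs $$ (i, j)) + of_nat d)"
      unfolding b_def
      by (intro eq_matI)
        (auto simp: b_index[OF principal_character_in] laplacian_index one[of "\<alpha> _ _"] simp flip: n_def)
    then show ?thesis
      using det_laplacian_add_const[OF assms(1,7,8)] by (simp add: n_def)
  qed
  have nonprincipal: "det (b \<chi>) = char_extend \<chi> (stickelberger X \<alpha> vs)"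
    if "\<chi> \<in> characters - {principal_character}" for \<chi>
  proof -
    have "b \<chi> = mat n n (\<lambda>(i, j). (if i = j then of_nat (out_degree (with_proj X) (vs ! i)) else 0) -
        (if (vs ! i, vs ! j) \<in> parcs X then \<chi> (\<alpha> (vs ! i) (vs ! j)) else 0))"
      unfolding b_def using that by (intro eq_matI) (simp_all add: b_index)
    then show ?thesis
      using char_extend_stickelberger[of \<chi> X \<alpha> vs] that by (simp add: n_def)
  qed
  have "mat (length ws) (length ws) (\<lambda>(r, c). complex_of_int (laplacian ?Y ws $$ (r, c)) + 1) =
      mat (length ws) (length ws)
        (\<lambda>(r, c). m (fst (ws ! r)) (fst (ws ! c)) (snd (ws ! c) - snd (ws ! r)))"
  proof (rule eq_matI; simp)
    fix r c assume rc: "r < length ws" "c < length ws"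
    obtain u g v h where ug: "ws ! r = (u, g)" "ws ! c = (v, h)" by fastforce
    have "r = c \<longleftrightarrow> u = v \<and> h - g = 0"
      using rc ws(1) ug by (auto simp: nth_eq_iff_index_eq[symmetric])
    moreover have "((u, g), (v, h)) \<in> parcs ?Y \<longleftrightarrow> (u, v) \<in> parcs X \<and> h - g = \<alpha> u v"
      by (auto simp: derived_graph_def algebra_simps)
    ultimately show "complex_of_int (laplacian ?Y ws $$ (r, c)) + 1 =
        m (fst (ws ! r)) (fst (ws ! c)) (snd (ws ! c) - snd (ws ! r))"
      using rc by (simp add: laplacian_index ug m_def out_degree_derived_graph)
  qed
  then have "of_nat ((n * d) ^ 2) * of_nat (Coset.order (jacobian ?Y ws l)) =
      (\<Prod>\<chi>\<in>characters. det (b \<chi>))"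
    using det_laplacian_add_const[OF pair_graph_derived_graph[OF assms(1,5)] assms(9,10), of 1]
      det_translation_invariant[OF vs ws, of m] n
    by (simp add: len b_def n_def)
  also have "\<dots> = det (b principal_character) * (\<Prod>\<chi>\<in>characters - {principal_character}. det (b \<chi>))"
    by (rule prod.remove[OF finite_characters principal_character_in])
  also have "\<dots> = of_nat d * of_nat (n ^ 2) * of_nat (Coset.order (jacobian X vs k)) *
      (\<Prod>\<chi>\<in>characters - {principal_character}. char_extend \<chi> (stickelberger X \<alpha> vs))"
    by (simp add: principal nonprincipal)
  \<comment> \<open>Dividing by the nonzero factor n^2 d^2 leaves 1/d, one \<open>d\<close> having
    come from the trivial block.\<close>
  finally show ?thesis
    using n d by (simp add: field_simps power2_eq_square)
qed

end
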